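(* Let $0<H<1$, $0<K\leq 1$ and $T>0$. Let $\{W_t^{H,K}, 0\leq t\leq T\}$ be a bifractional Brownian motion with parameters $H,K$, and let $Y^{(1)}_t=2^{(1-K)/2}W^{HK}(t)$, $0\leq t\leq T$, where $W^{HK}$ is a fractional Brownian motion with Hurst index $HK$. Then, for any non-decreasing convex function $g:\mathbb{R}_+\to\mathbb{R}$, $$E\Big[g\Big(\sup_{0\leq t,s\leq T}(W_t^{H,K}-W_s^{H,K})\Big)\Big]\leq E\Big[g\Big(\sup_{0\leq t,s\leq T}(Y_t^{(1)}-Y_s^{(1)})\Big)\Big]$$ and $$E\Big[\sup_{0\leq t\leq T}W_t^{H,K}\Big]\leq E\Big[\sup_{0\leq t\leq T}Y_t^{(1)}\Big].$$
   Context: A bifractional Brownian motion with parameters $H\in(0,1)$, $K\in(0,1]$ is a centered Gaussian process $\{W_t^{H,K},t\geq 0\}$ with covariance function $$C_H(s,t)=\frac{1}{2^K}\big[(t^{2H}+s^{2H})^K-|s-t|^{2HK}\big].$$ A fractional Brownian motion with Hurst index $h\in(0,1)$ is a centered Gaussian process with covariance function $\frac12(t^{2h}+s^{2h}-|t-s|^{2h})$; here $h=HK$. All processes are assumed to have almost surely continuous sample paths on $[0,T]$. $\mathbb{R}_+=[0,\infty)$. *)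

theory Defs
  imports "HOL-Probability.Probability"
begin

text \<open>Degenerate (almost surely constant) variables count as Gaussian: the processes below vanish
  almost surely at time 0.\<close>

definition gaussian_rv :: "'a measure \<Rightarrow> ('a \<Rightarrow> real) \<Rightarrow> bool" where
  "gaussian_rv M X \<longleftrightarrow> X \<in> borel_measurable M \<and>
     (\<exists>\<mu>. (AE \<omega> in M. X \<omega> = \<mu>) \<or>
          (\<exists>\<sigma>>0. distributed M lborel X (\<lambda>x. ennreal (normal_density \<mu> \<sigma> x))))"

text \<open>Joint Gaussianity of the finite-dimensional distributions: every finite linear combination
  of the coordinates is Gaussian.\<close>

definition gaussian_process :: "'a measure \<Rightarrow> 'i set \<Rightarrow> ('i \<Rightarrow> 'a \<Rightarrow> real) \<Rightarrow> bool" where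
  "gaussian_process M I X \<longleftrightarrow> prob_space M \<and>
     (\<forall>t\<in>I. X t \<in> borel_measurable M) \<and>
     (\<forall>J a. finite J \<and> J \<subseteq> I \<longrightarrow> gaussian_rv M (\<lambda>\<omega>. \<Sum>t\<in>J. a t * X t \<omega>))"

definition covariance :: "'a measure \<Rightarrow> ('a \<Rightarrow> real) \<Rightarrow> ('a \<Rightarrow> real) \<Rightarrow> real" where
  "covariance M X Y =
     (\<integral>\<omega>. (X \<omega> - (\<integral>\<eta>. X \<eta> \<partial>M)) * (Y \<omega> - (\<integral>\<eta>. Y \<eta> \<partial>M)) \<partial>M)"

definition centered_gaussian_process ::
  "'a measure \<Rightarrow> 'i set \<Rightarrow> ('i \<Rightarrow> 'i \<Rightarrow> real) \<Rightarrow> ('i \<Rightarrow> 'a \<Rightarrow> real) \<Rightarrow> bool" where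
  "centered_gaussian_process M I C X \<longleftrightarrow> gaussian_process M I X \<and>
     (\<forall>t\<in>I. (\<integral>\<omega>. X t \<omega> \<partial>M) = 0) \<and>
     (\<forall>s\<in>I. \<forall>t\<in>I. covariance M (X s) (X t) = C s t)"

definition bifractional_cov :: "real \<Rightarrow> real \<Rightarrow> real \<Rightarrow> real \<Rightarrow> real" where
  "bifractional_cov H K s t =
     1 / 2 powr K * ((t powr (2 * H) + s powr (2 * H)) powr K - \<bar>s - t\<bar> powr (2 * H * K))"

definition fractional_cov :: "real \<Rightarrow> real \<Rightarrow> real \<Rightarrow> real" where
  "fractional_cov h s t =
     1 / 2 * (t powr (2 * h) + s powr (2 * h) - \<bar>t - s\<bar> powr (2 * h))"

text \<open>The time set \<open>I\<close> is a parameter, so that the processes may be given on a time interval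
  \<open>{0..T}\<close> only.\<close>

definition bifractional_brownian_motion ::
  "'a measure \<Rightarrow> real set \<Rightarrow> real \<Rightarrow> real \<Rightarrow> (real \<Rightarrow> 'a \<Rightarrow> real) \<Rightarrow> bool" where
  "bifractional_brownian_motion M I H K W \<longleftrightarrow>
     0 < H \<and> H < 1 \<and> 0 < K \<and> K \<le> 1 \<and> I \<subseteq> {0..} \<and>
     centered_gaussian_process M I (bifractional_cov H K) W"

definition fractional_brownian_motion ::
  "'a measure \<Rightarrow> real set \<Rightarrow> real \<Rightarrow> (real \<Rightarrow> 'a \<Rightarrow> real) \<Rightarrow> bool" where
  "fractional_brownian_motion M I h B \<longleftrightarrow>
     0 < h \<and> h < 1 \<and> I \<subseteq> {0..} \<and>
     centered_gaussian_process M I (fractional_cov h) B"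

definition continuous_paths ::
  "'a measure \<Rightarrow> real set \<Rightarrow> (real \<Rightarrow> 'a \<Rightarrow> real) \<Rightarrow> bool" where
  "continuous_paths M I X \<longleftrightarrow> (AE \<omega> in M. continuous_on I (\<lambda>t. X t \<omega>))"

text \<open>Expectation with values in \<open>[-\<infinity>, \<infinity>]\<close>: the Bochner integral is \<open>0\<close> on non-integrable functions,
  whereas a convex function of a supremum may have expectation \<open>\<infinity>\<close>. The coercion \<open>ennreal\<close> cuts
  off negative values, so the two integrals are those of the positive and the negative part. The
  difference is meaningful when one of them is finite. A supremum over an interval of a process
  with almost surely continuous paths need not be measurable, but it agrees almost everywhere with
  a measurable function, and the nonnegative integral depends on the integrand only up to
  almost-everywhere equality.\<close>

definition extended_expectation :: "'a measure \<Rightarrow> ('a \<Rightarrow> real) \<Rightarrow> ereal" where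
  "extended_expectation M f =
     enn2ereal (\<integral>\<^sup>+\<omega>. ennreal (f \<omega>) \<partial>M) - enn2ereal (\<integral>\<^sup>+\<omega>. ennreal (- f \<omega>) \<partial>M)"

end

theory Submission
  imports Defs
begin

text \<open>Both processes are compared through the variances of their increments: by concavity of
  \<open>x powr K\<close>, those of \<open>W\<close> are dominated by those of \<open>Y\<close>. For finitely many times this implies
  Vitale's form of the Sudakov--Fernique inequality, by a Lindeberg argument. Let \<open>X\<close>, \<open>Y\<close> be independent
  Gaussian vectors and \<open>u s\<close> the expectation of a smooth approximation of \<open>max (max_range J) a\<close> at
  \<open>sqrt (1 - s) * X + sqrt s * Y\<close>. In law, the vectors at \<open>s\<close> and \<open>s + \<epsilon>\<close> arise from a common
  vector by adding \<open>sqrt \<epsilon>\<close> times an independent copy of \<open>X\<close>, respectively \<open>Y\<close>; a third order Taylor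
  expansion shows that \<open>u\<close> decreases by at most a multiple of \<open>\<epsilon> powr (3/2)\<close>, hence \<open>u 0 \<le> u 1\<close>.
  A convex nondecreasing function is a limit of sums of hinge functions, and the supremum over the
  interval is a limit of maxima over finite sets. The second inequality is the case of the identity,
  since by symmetry the expected range is twice the expected maximum.\<close>

section \<open>Joint laws and characteristic functions\<close>

text \<open>The factor in front of \<open>B\<close> is dictated by the increments: the variance of
  an increment of \<open>W\<close> is \<open>2 powr (1 - K)\<close> times the fractional one plus a
  term that concavity makes nonpositive. Such a comparison of increments does not order the
  variances at single times, which is why the range, a function of differences only, is the quantity
  carried through the interpolation. The threshold \<open>a\<close> is kept throughout because the
  expectations of \<open>max U a\<close> for all \<open>a\<close> control every nondecreasing convex
  function of \<open>U\<close>. Covariance matrices may be singular, as both processes vanish almost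
  surely at time 0, so densities of Gaussian vectors are avoided: all identities in law come from
  characteristic functions, with the vector case reduced to the real one by treating indicators of
  the other coordinates as weights. The error exponent 3/2 suffices since \<open>n\<close> steps of
  length \<open>1 / n\<close> then cost a multiple of \<open>1 / sqrt n\<close> in total.\<close>

lemma weighted_distribution:
  fixes w Z :: "'a \<Rightarrow> real"
  assumes "prob_space M"
    and [measurable]: "w \<in> borel_measurable M" "Z \<in> borel_measurable M"
    and w: "\<And>\<omega>. 0 \<le> w \<omega>" "\<And>\<omega>. w \<omega> \<le> c"
    and m: "0 < m" "(\<integral>\<omega>. w \<omega> \<partial>M) = m"
  defines "D \<equiv> distr (density M (\<lambda>\<omega>. ennreal (w \<omega> / m))) borel Z"
  shows "real_distribution D"
    and "char D t = (CLINT \<omega>|M. w \<omega> *\<^sub>R iexp (t * Z \<omega>)) / m"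
    and "A \<in> sets borel \<Longrightarrow> measure D A = (\<integral>\<omega>. w \<omega> * indicator A (Z \<omega>) \<partial>M) / m"
proof -
  interpret prob_space M by fact
  have iw: "integrable M w"
    by (rule integrable_const_bound[where B=c]) (use w in auto)
  have "(\<integral>\<^sup>+\<omega>. ennreal (w \<omega> / m) \<partial>M) = ennreal (\<integral>\<omega>. w \<omega> / m \<partial>M)"
    using iw w m by (intro nn_integral_eq_integral) auto
  also have "\<dots> = 1" using m by simp
  finally have P: "prob_space (density M (\<lambda>\<omega>. ennreal (w \<omega> / m)))"
    by (intro prob_spaceI) (simp add: emeasure_density)
  then interpret P: prob_space "density M (\<lambda>\<omega>. ennreal (w \<omega> / m))" .
  show rd: "real_distribution D" unfolding D_def
    by (rule P.real_distribution_distr) simp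
  have "char D t = (CLINT \<omega>|M. (w \<omega> / m) *\<^sub>R iexp (t * Z \<omega>))"
    unfolding char_def D_def using w m
    by (subst integral_distr) (auto simp: integral_density)
  also have "\<dots> = (CLINT \<omega>|M. (w \<omega> *\<^sub>R iexp (t * Z \<omega>)) / m)"
    by (simp add: scaleR_conv_of_real)
  finally show "char D t = (CLINT \<omega>|M. w \<omega> *\<^sub>R iexp (t * Z \<omega>)) / m"
    by simp
  assume A: "A \<in> sets borel"
  interpret D: real_distribution D by fact
  have "measure D A = (\<integral>x. indicator A x \<partial>D)"
    using A by (simp add: D_def)
  also have "\<dots> = (\<integral>\<omega>. (w \<omega> / m) *\<^sub>R indicator A (Z \<omega>) \<partial>M)"
    unfolding D_def using w m A
    by (subst integral_distr) (auto simp: integral_density)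
  finally show "measure D A = (\<integral>\<omega>. w \<omega> * indicator A (Z \<omega>) \<partial>M) / m"
    by simp
qed

text \<open>The argument \<open>t = 0\<close> of the hypothesis shows that both weights have the
  same total mass \<open>m\<close>. If \<open>m\<close> is positive, division by it turns them into
  densities of probability laws and Levy's uniqueness theorem applies; if \<open>m = 0\<close>, both
  weights vanish almost everywhere and there is nothing to compare.\<close>

lemma weighted_cf_unique:
  fixes w Z :: "'a \<Rightarrow> real" and w' Z' :: "'b \<Rightarrow> real"
  assumes M: "prob_space M" "w \<in> borel_measurable M" "Z \<in> borel_measurable M"
    and w: "\<And>\<omega>. 0 \<le> w \<omega>" "\<And>\<omega>. w \<omega> \<le> c"
    and M': "prob_space M'" "w' \<in> borel_measurable M'" "Z' \<in> borel_measurable M'"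
    and w': "\<And>\<omega>. 0 \<le> w' \<omega>" "\<And>\<omega>. w' \<omega> \<le> c"
    and eq: "\<And>t. (CLINT \<omega>|M. w \<omega> *\<^sub>R iexp (t * Z \<omega>)) = (CLINT \<omega>|M'. w' \<omega> *\<^sub>R iexp (t * Z' \<omega>))"
    and A: "A \<in> sets borel"
  shows "(\<integral>\<omega>. w \<omega> * indicator A (Z \<omega>) \<partial>M) = (\<integral>\<omega>. w' \<omega> * indicator A (Z' \<omega>) \<partial>M')"
proof -
  interpret M: prob_space M by fact
  interpret M': prob_space M' by fact
  note [measurable] = M(2,3) M'(2,3) A
  have iw: "integrable M w" "integrable M' w'"
    by (rule M.integrable_const_bound[where B=c] M'.integrable_const_bound[where B=c];
        use w w' in auto)+
  define m where "m = (\<integral>\<omega>. w \<omega> \<partial>M)"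
  have m': "(\<integral>\<omega>. w' \<omega> \<partial>M') = m"
    using eq[of 0] by (simp add: m_def scaleR_conv_of_real)
  have "0 \<le> m" unfolding m_def using w by (intro Bochner_Integration.integral_nonneg) auto
  then consider "m = 0" | "0 < m" by linarith
  then show ?thesis
  proof cases
    case 1
    have "AE \<omega> in M. w \<omega> = 0"
      using 1 iw w integral_nonneg_eq_0_iff_AE[of M w] by (simp add: m_def)
    then have "(\<integral>\<omega>. w \<omega> * indicator A (Z \<omega>) \<partial>M) = (\<integral>\<omega>. 0 \<partial>M)"
      by (intro integral_cong_AE) auto
    moreover have "AE \<omega> in M'. w' \<omega> = 0"
      using 1 iw w' m' integral_nonneg_eq_0_iff_AE[of M' w'] by simp
    then have "(\<integral>\<omega>. w' \<omega> * indicator A (Z' \<omega>) \<partial>M') = (\<integral>\<omega>. 0 \<partial>M')"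
      by (intro integral_cong_AE) auto
    ultimately show ?thesis by simp
  next
    case 2
    note D = weighted_distribution[OF M w 2 m_def[symmetric]]
    note D' = weighted_distribution[OF M' w' 2 m']
    have "distr (density M (\<lambda>\<omega>. ennreal (w \<omega> / m))) borel Z =
          distr (density M' (\<lambda>\<omega>. ennreal (w' \<omega> / m))) borel Z'"
      by (rule Levy_uniqueness[OF D(1) D'(1)]) (rule ext, simp only: D(2) D'(2) eq)
    then show ?thesis using D(3)[OF A] D'(3)[OF A] 2 by simp
  qed
qed

text \<open>The induction converts one coordinate at a time from an exponential into an indicator.
  With the indicators already obtained as weight, varying the coefficient of \<open>X k\<close>
  produces the characteristic function of \<open>X k\<close> under that weight, and real uniqueness
  yields the indicator of \<open>A k\<close>. All of \<open>J\<close> stays in the exponent and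
  \<open>a\<close> is arbitrary, so that adding a multiple of a unit vector to \<open>a\<close>
  stays within the induction hypothesis.\<close>

lemma cf_unique_boxes:
  fixes X :: "'i \<Rightarrow> 'a \<Rightarrow> real" and X' :: "'i \<Rightarrow> 'b \<Rightarrow> real"
  assumes M: "prob_space M" "\<And>j. j \<in> J \<Longrightarrow> X j \<in> borel_measurable M"
    and M': "prob_space M'" "\<And>j. j \<in> J \<Longrightarrow> X' j \<in> borel_measurable M'"
    and J: "finite J"
    and eq: "\<And>a. (CLINT \<omega>|M. iexp (\<Sum>j\<in>J. a j * X j \<omega>)) = (CLINT \<omega>|M'. iexp (\<Sum>j\<in>J. a j * X' j \<omega>))"
    and A: "\<And>j. j \<in> J \<Longrightarrow> A j \<in> sets borel"
    and S: "S \<subseteq> J"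
  shows "(CLINT \<omega>|M. (\<Prod>j\<in>S. indicator (A j) (X j \<omega>) :: real) *\<^sub>R iexp (\<Sum>j\<in>J. a j * X j \<omega>)) =
         (CLINT \<omega>|M'. (\<Prod>j\<in>S. indicator (A j) (X' j \<omega>) :: real) *\<^sub>R iexp (\<Sum>j\<in>J. a j * X' j \<omega>))"
proof -
  interpret M: prob_space M by fact
  interpret M': prob_space M' by fact
  have "finite S" using S J finite_subset by auto
  from this S show ?thesis
  proof (induction S arbitrary: a)
    case empty
    then show ?case using eq by simp
  next
    case (insert k S)
    have kJ: "k \<in> J" and SJ: "S \<subseteq> J" using insert by auto
    note IH = insert.IH[OF SJ]
    note [measurable] = M(2) M'(2)
    define v where "v \<omega> = (\<Prod>j\<in>S. indicator (A j) (X j \<omega>) :: real)" for \<omega>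
    define v' where "v' \<omega> = (\<Prod>j\<in>S. indicator (A j) (X' j \<omega>) :: real)" for \<omega>
    define \<theta> where "\<theta> a \<omega> = (\<Sum>j\<in>J. a j * X j \<omega>)" for a \<omega>
    define \<theta>' where "\<theta>' a \<omega> = (\<Sum>j\<in>J. a j * X' j \<omega>)" for a \<omega>
    have ind: "(\<lambda>\<omega>. indicator (A j) (X j \<omega>) :: real) \<in> borel_measurable M"
              "(\<lambda>\<omega>. indicator (A j) (X' j \<omega>) :: real) \<in> borel_measurable M'" if "j \<in> J" for j
      using that A[OF that] by measurable
    have vm[measurable]: "v \<in> borel_measurable M" "v' \<in> borel_measurable M'"
      unfolding v_def v'_def using ind SJ by (auto intro!: borel_measurable_prod)
    have tm[measurable]: "\<theta> b \<in> borel_measurable M" "\<theta>' b \<in> borel_measurable M'" for b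
      unfolding \<theta>_def \<theta>'_def by measurable
    have vb: "0 \<le> v \<omega>" "v \<omega> \<le> 1" for \<omega>
      unfolding v_def by (auto intro!: prod_nonneg prod_le_1)
    have vb': "0 \<le> v' \<omega>" "v' \<omega> \<le> 1" for \<omega>
      unfolding v'_def by (auto intro!: prod_nonneg prod_le_1)
    have IH': "(CLINT \<omega>|M. v \<omega> *\<^sub>R iexp (\<theta> b \<omega>)) = (CLINT \<omega>|M'. v' \<omega> *\<^sub>R iexp (\<theta>' b \<omega>))" for b
      using IH[of b] by (simp add: v_def v'_def \<theta>_def \<theta>'_def)
    have int: "integrable M (\<lambda>\<omega>. v \<omega> *\<^sub>R iexp (\<theta> b \<omega>))" "integrable M' (\<lambda>\<omega>. v' \<omega> *\<^sub>R iexp (\<theta>' b \<omega>))" for b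
      using vb vb'
      by (auto intro!: M.integrable_const_bound[where B=1] M'.integrable_const_bound[where B=1])
    define e where "e t i = (if i = k then t else 0 :: real)" for t i
    have e: "\<theta> (e t) \<omega> = t * X k \<omega>" for t \<omega>
      using kJ J by (simp add: \<theta>_def e_def if_distrib[of "\<lambda>x. x * _"] cong: if_cong)
    have e': "\<theta>' (e t) \<omega> = t * X' k \<omega>" for t \<omega>
      using kJ J by (simp add: \<theta>'_def e_def if_distrib[of "\<lambda>x. x * _"] cong: if_cong)
    have add: "\<theta> (\<lambda>i. r * a i + e t i) \<omega> = r * \<theta> a \<omega> + t * X k \<omega>"
      "\<theta>' (\<lambda>i. r * a i + e t i) \<omega>' = r * \<theta>' a \<omega>' + t * X' k \<omega>'" for r t \<omega> \<omega>'
      unfolding e[symmetric] e'[symmetric]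
      by (simp_all add: \<theta>_def \<theta>'_def sum_distrib_left algebra_simps sum.distrib)
    have shift: "(CLINT \<omega>|M. v \<omega> *\<^sub>R iexp (r * \<theta> a \<omega> + t * X k \<omega>)) =
        (CLINT \<omega>|M'. v' \<omega> *\<^sub>R iexp (r * \<theta>' a \<omega> + t * X' k \<omega>))"
      "integrable M (\<lambda>\<omega>. v \<omega> *\<^sub>R iexp (r * \<theta> a \<omega> + t * X k \<omega>))"
      "integrable M' (\<lambda>\<omega>. v' \<omega> *\<^sub>R iexp (r * \<theta>' a \<omega> + t * X' k \<omega>))" for r t
      using IH'[of "\<lambda>i. r * a i + e t i"] int[of "\<lambda>i. r * a i + e t i"] by (simp_all only: add)
    have Ak: "A k \<in> sets borel" using A kJ .
    have [measurable]: "X k \<in> borel_measurable M" "X' k \<in> borel_measurable M'" using kJ by auto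
    let ?I = "\<lambda>\<omega>. indicator (A k) (X k \<omega>) :: real" and ?I' = "\<lambda>\<omega>. indicator (A k) (X' k \<omega>) :: real"
    have m[measurable]: "?I \<in> borel_measurable M" "?I' \<in> borel_measurable M'" using ind kJ by auto
    txt \<open>Levy's theorem needs nonnegative weights, so the cosine and the sine are shifted by 1.\<close>
    have 1: "(\<integral>\<omega>. v \<omega> * ?I \<omega> \<partial>M) = (\<integral>\<omega>. v' \<omega> * ?I' \<omega> \<partial>M')"
      using shift(1)[of 0] vb vb' Ak
      by (intro weighted_cf_unique[where c=1] M(1) M'(1)) auto
    \<comment> \<open>Euler's formulas: the cosine and the sine of \<open>\<theta> a\<close> are
      combinations of the exponentials with \<open>r = 1\<close> and \<open>r = -1\<close>, and the
      constant 1 is the case \<open>r = 0\<close>. All three are covered by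
      \<open>shift\<close>.\<close>
    have co: "(v \<omega> * (1 + cos (\<theta> a \<omega>))) *\<^sub>R iexp (t * X k \<omega>) =
      v \<omega> *\<^sub>R iexp (0 * \<theta> a \<omega> + t * X k \<omega>) + (v \<omega> *\<^sub>R iexp (1 * \<theta> a \<omega> + t * X k \<omega>) + v \<omega> *\<^sub>R iexp ((-1) * \<theta> a \<omega> + t * X k \<omega>)) / 2"
      for t \<omega>
      by (simp add: complex_eq_iff Re_exp Im_exp cos_add sin_add cos_diff sin_diff algebra_simps)
    have co': "(v' \<omega> * (1 + cos (\<theta>' a \<omega>))) *\<^sub>R iexp (t * X' k \<omega>) =
      v' \<omega> *\<^sub>R iexp (0 * \<theta>' a \<omega> + t * X' k \<omega>) + (v' \<omega> *\<^sub>R iexp (1 * \<theta>' a \<omega> + t * X' k \<omega>) + v' \<omega> *\<^sub>R iexp ((-1) * \<theta>' a \<omega> + t * X' k \<omega>)) / 2"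
      for t \<omega>
      by (simp add: complex_eq_iff Re_exp Im_exp cos_add sin_add cos_diff sin_diff algebra_simps)
    have si: "(v \<omega> * (1 + sin (\<theta> a \<omega>))) *\<^sub>R iexp (t * X k \<omega>) =
      v \<omega> *\<^sub>R iexp (0 * \<theta> a \<omega> + t * X k \<omega>) + (v \<omega> *\<^sub>R iexp (1 * \<theta> a \<omega> + t * X k \<omega>) - v \<omega> *\<^sub>R iexp ((-1) * \<theta> a \<omega> + t * X k \<omega>)) * (- \<i> / 2)"
      for t \<omega>
      by (simp add: complex_eq_iff Re_exp Im_exp cos_add sin_add cos_diff sin_diff field_simps)
    have si': "(v' \<omega> * (1 + sin (\<theta>' a \<omega>))) *\<^sub>R iexp (t * X' k \<omega>) =
      v' \<omega> *\<^sub>R iexp (0 * \<theta>' a \<omega> + t * X' k \<omega>) + (v' \<omega> *\<^sub>R iexp (1 * \<theta>' a \<omega> + t * X' k \<omega>) - v' \<omega> *\<^sub>R iexp ((-1) * \<theta>' a \<omega> + t * X' k \<omega>)) * (- \<i> / 2)"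
      for t \<omega>
      by (simp add: complex_eq_iff Re_exp Im_exp cos_add sin_add cos_diff sin_diff field_simps)
    have bd: "0 \<le> 1 + cos x" "1 + cos x \<le> 2" "0 \<le> 1 + sin x" "1 + sin x \<le> 2" for x :: real
      using cos_ge_minus_one[of x] cos_le_one[of x] sin_ge_minus_one[of x] sin_le_one[of x]
      by linarith+
    have mb: "0 \<le> x * y \<and> x * y \<le> 2" if "0 \<le> x" "x \<le> 1" "0 \<le> y" "y \<le> 2" for x y :: real
      using that mult_mono[of x 1 y 2] by auto
    have 2: "(\<integral>\<omega>. v \<omega> * (1 + cos (\<theta> a \<omega>)) * ?I \<omega> \<partial>M) = (\<integral>\<omega>. v' \<omega> * (1 + cos (\<theta>' a \<omega>)) * ?I' \<omega> \<partial>M')"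
    proof (rule weighted_cf_unique[where c=2])
      fix t
      show "(CLINT \<omega>|M. (v \<omega> * (1 + cos (\<theta> a \<omega>))) *\<^sub>R iexp (t * X k \<omega>)) =
        (CLINT \<omega>|M'. (v' \<omega> * (1 + cos (\<theta>' a \<omega>))) *\<^sub>R iexp (t * X' k \<omega>))"
        unfolding co co' using shift(2,3)
        by (subst (1 2) Bochner_Integration.integral_add integral_divide_zero,
            auto simp only: Bochner_Integration.integral_add integral_divide_zero shift(1)
              intro!: integrable_divide_zero Bochner_Integration.integrable_add)
    qed (use M(1) M'(1) vb vb' bd mb Ak in auto)
    have 3: "(\<integral>\<omega>. v \<omega> * (1 + sin (\<theta> a \<omega>)) * ?I \<omega> \<partial>M) = (\<integral>\<omega>. v' \<omega> * (1 + sin (\<theta>' a \<omega>)) * ?I' \<omega> \<partial>M')"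
    proof (rule weighted_cf_unique[where c=2])
      fix t
      show "(CLINT \<omega>|M. (v \<omega> * (1 + sin (\<theta> a \<omega>))) *\<^sub>R iexp (t * X k \<omega>)) =
        (CLINT \<omega>|M'. (v' \<omega> * (1 + sin (\<theta>' a \<omega>))) *\<^sub>R iexp (t * X' k \<omega>))"
        unfolding si si' using shift(2,3)
        by (subst (1 2) Bochner_Integration.integral_add,
            auto simp only: Bochner_Integration.integral_diff integral_mult_left_zero shift(1)
              intro!: integrable_mult_left Bochner_Integration.integrable_diff)
    qed (use M(1) M'(1) vb vb' bd mb Ak in auto)
    have Ib: "0 \<le> ?I \<omega>" "?I \<omega> \<le> 1" "0 \<le> ?I' \<omega>'" "?I' \<omega>' \<le> 1" for \<omega> \<omega>'
      by (auto simp: indicator_def)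
    have mb2: "\<bar>x * y * z\<bar> \<le> 2"
      if "0 \<le> x" "x \<le> 1" "0 \<le> y" "y \<le> 2" "0 \<le> z" "z \<le> 1" for x y z :: real
      using mb[OF that(1-4)] mult_mono[of "x * y" 2 z 1] that by auto
    have mb3: "\<bar>x * z\<bar> \<le> 2"
      if "0 \<le> x" "x \<le> 1" "0 \<le> z" "z \<le> 1" for x z :: real
      using mb2[of x 1 z] that by simp
    have intI: "integrable M f" if "f \<in> borel_measurable M" "\<And>\<omega>. \<bar>f \<omega>\<bar> \<le> 2" for f :: "'a \<Rightarrow> real"
      using that by (intro M.integrable_const_bound[where B=2]) auto
    have intI': "integrable M' f" if "f \<in> borel_measurable M'" "\<And>\<omega>. \<bar>f \<omega>\<bar> \<le> 2" for f :: "'b \<Rightarrow> real"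
      using that by (intro M'.integrable_const_bound[where B=2]) auto
    have tri: "(\<lambda>\<omega>. 1 + cos (\<theta> a \<omega>)) \<in> borel_measurable M" "(\<lambda>\<omega>. 1 + sin (\<theta> a \<omega>)) \<in> borel_measurable M"
      "(\<lambda>\<omega>. 1 + cos (\<theta>' a \<omega>)) \<in> borel_measurable M'" "(\<lambda>\<omega>. 1 + sin (\<theta>' a \<omega>)) \<in> borel_measurable M'"
      by measurable
    have int2: "integrable M (\<lambda>\<omega>. v \<omega> * ?I \<omega>)" "integrable M' (\<lambda>\<omega>. v' \<omega> * ?I' \<omega>)"
      "integrable M (\<lambda>\<omega>. v \<omega> * (1 + cos (\<theta> a \<omega>)) * ?I \<omega>)" "integrable M' (\<lambda>\<omega>. v' \<omega> * (1 + cos (\<theta>' a \<omega>)) * ?I' \<omega>)"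
      "integrable M (\<lambda>\<omega>. v \<omega> * (1 + sin (\<theta> a \<omega>)) * ?I \<omega>)" "integrable M' (\<lambda>\<omega>. v' \<omega> * (1 + sin (\<theta>' a \<omega>)) * ?I' \<omega>)"
      by (rule intI intI' borel_measurable_times vm m tri | rule mb2 mb3 vb vb' bd Ib)+
    \<comment> \<open>The shift by 1 is undone here: \<open>exp (i x)\<close> equals
      \<open>(1 + cos x) + i (1 + sin x) - (1 + i)\<close>, and each of the three resulting real
      integrals has been identified.\<close>
    have split: "(v \<omega> * ?I \<omega>) *\<^sub>R iexp (\<theta> a \<omega>) =
        complex_of_real (v \<omega> * (1 + cos (\<theta> a \<omega>)) * ?I \<omega>) + \<i> * complex_of_real (v \<omega> * (1 + sin (\<theta> a \<omega>)) * ?I \<omega>)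
        - (1 + \<i>) * complex_of_real (v \<omega> * ?I \<omega>)" for \<omega>
      by (simp add: complex_eq_iff Re_exp Im_exp algebra_simps)
    have split': "(v' \<omega> * ?I' \<omega>) *\<^sub>R iexp (\<theta>' a \<omega>) =
        complex_of_real (v' \<omega> * (1 + cos (\<theta>' a \<omega>)) * ?I' \<omega>) + \<i> * complex_of_real (v' \<omega> * (1 + sin (\<theta>' a \<omega>)) * ?I' \<omega>)
        - (1 + \<i>) * complex_of_real (v' \<omega> * ?I' \<omega>)" for \<omega>
      by (simp add: complex_eq_iff Re_exp Im_exp algebra_simps)
    have "(CLINT \<omega>|M. (v \<omega> * ?I \<omega>) *\<^sub>R iexp (\<theta> a \<omega>)) = (CLINT \<omega>|M'. (v' \<omega> * ?I' \<omega>) *\<^sub>R iexp (\<theta>' a \<omega>))"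
      unfolding split split' using int2
      by (simp only: Bochner_Integration.integral_diff Bochner_Integration.integral_add integrable_of_real
         integrable_mult_right Bochner_Integration.integrable_add integral_mult_right_zero integral_of_real 1 2 3)
    moreover have "v \<omega> * ?I \<omega> = (\<Prod>j\<in>insert k S. indicator (A j) (X j \<omega>))" for \<omega>
      using insert.hyps by (simp add: v_def mult.commute)
    moreover have "v' \<omega> * ?I' \<omega> = (\<Prod>j\<in>insert k S. indicator (A j) (X' j \<omega>))" for \<omega>
      using insert.hyps by (simp add: v'_def mult.commute)
    ultimately show ?case by (simp add: \<theta>_def \<theta>'_def)
  qed
qed

text \<open>With indicators in every coordinate and the zero vector in the exponent, the preceding
  lemma compares the two laws on boxes, which generate the product sigma-algebra and are stable
  under intersection.\<close>

lemma joint_cf_unique: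
  fixes X :: "'i \<Rightarrow> 'a \<Rightarrow> real" and X' :: "'i \<Rightarrow> 'b \<Rightarrow> real"
  assumes M: "prob_space M" "\<And>j. j \<in> J \<Longrightarrow> X j \<in> borel_measurable M"
    and M': "prob_space M'" "\<And>j. j \<in> J \<Longrightarrow> X' j \<in> borel_measurable M'"
    and J: "finite J"
    and eq: "\<And>a. (CLINT \<omega>|M. iexp (\<Sum>j\<in>J. a j * X j \<omega>)) = (CLINT \<omega>|M'. iexp (\<Sum>j\<in>J. a j * X' j \<omega>))"
  shows "distr M (\<Pi>\<^sub>M j\<in>J. borel) (\<lambda>\<omega>. \<lambda>j\<in>J. X j \<omega>) = distr M' (\<Pi>\<^sub>M j\<in>J. borel) (\<lambda>\<omega>. \<lambda>j\<in>J. X' j \<omega>)"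
    (is "?D = ?D'")
proof -
  interpret M: prob_space M by fact
  interpret M': prob_space M' by fact
  note [measurable] = M(2) M'(2)
  have V[measurable]: "(\<lambda>\<omega>. \<lambda>j\<in>J. X j \<omega>) \<in> measurable M (\<Pi>\<^sub>M j\<in>J. borel)"
    by (rule measurable_restrict) (use M in auto)
  have V'[measurable]: "(\<lambda>\<omega>. \<lambda>j\<in>J. X' j \<omega>) \<in> measurable M' (\<Pi>\<^sub>M j\<in>J. borel)"
    by (rule measurable_restrict) (use M' in auto)
  interpret D: prob_space ?D by (rule M.prob_space_distr) fact
  interpret D': prob_space ?D' by (rule M'.prob_space_distr) fact
  show ?thesis
  proof (rule measure_eqI_PiM_finite[OF J, where M="\<lambda>_. borel" and A="\<lambda>_::nat. \<Pi>\<^sub>E j\<in>J. UNIV"])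
    fix A :: "'i \<Rightarrow> real set" assume A: "\<And>j. j \<in> J \<Longrightarrow> A j \<in> sets borel"
    have ind: "(\<Prod>j\<in>J. indicator (A j) (Y j) :: real) = indicator (Pi\<^sub>E J A) (\<lambda>j\<in>J. Y j)" for Y
      using J by (auto simp: indicator_def PiE_def Pi_def prod_zero_iff)
    have meas: "Pi\<^sub>E J A \<in> sets (\<Pi>\<^sub>M j\<in>J. borel)"
      using A J by (intro sets_PiM_I_finite) auto
    have "measure ?D (Pi\<^sub>E J A) = (\<integral>x. indicator (Pi\<^sub>E J A) x \<partial>?D)"
      using meas by simp
    also have "\<dots> = (\<integral>\<omega>. (\<Prod>j\<in>J. indicator (A j) (X j \<omega>)) \<partial>M)"
      unfolding ind using meas by (subst integral_distr) auto
    finally have 1: "complex_of_real (measure ?D (Pi\<^sub>E J A)) =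
        (CLINT \<omega>|M. (\<Prod>j\<in>J. indicator (A j) (X j \<omega>) :: real) *\<^sub>R iexp (\<Sum>j\<in>J. 0 * X j \<omega>))"
      by (simp add: scaleR_conv_of_real del: of_real_prod)
    have "measure ?D' (Pi\<^sub>E J A) = (\<integral>x. indicator (Pi\<^sub>E J A) x \<partial>?D')"
      using meas by simp
    also have "\<dots> = (\<integral>\<omega>. (\<Prod>j\<in>J. indicator (A j) (X' j \<omega>)) \<partial>M')"
      unfolding ind using meas by (subst integral_distr) auto
    finally have 2: "complex_of_real (measure ?D' (Pi\<^sub>E J A)) =
        (CLINT \<omega>|M'. (\<Prod>j\<in>J. indicator (A j) (X' j \<omega>) :: real) *\<^sub>R iexp (\<Sum>j\<in>J. 0 * X' j \<omega>))"
      by (simp add: scaleR_conv_of_real del: of_real_prod)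
    have "complex_of_real (measure ?D (Pi\<^sub>E J A)) = complex_of_real (measure ?D' (Pi\<^sub>E J A))"
      unfolding 1 2 by (rule cf_unique_boxes[OF M M' J eq A]) auto
    then have "measure ?D (Pi\<^sub>E J A) = measure ?D' (Pi\<^sub>E J A)" by simp
    then show "emeasure ?D (Pi\<^sub>E J A) = emeasure ?D' (Pi\<^sub>E J A)"
      by (simp add: D.emeasure_eq_measure D'.emeasure_eq_measure)
  next
    show "range (\<lambda>_::nat. \<Pi>\<^sub>E j\<in>J. UNIV :: real set) \<subseteq> prod_algebra J (\<lambda>_. borel)"
      using J by (auto intro!: prod_algebraI_finite)
  qed (auto simp: space_PiM)
qed

section \<open>Centered Gaussian processes\<close>

text \<open>Writing the characteristic function through the second moment covers the degenerate case
  as well: there mean zero forces the constant to be 0, and both sides equal 1.\<close>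

lemma centered_gaussian_rv:
  assumes M: "prob_space M" and X: "gaussian_rv M X" "(\<integral>\<omega>. X \<omega> \<partial>M) = 0"
  shows "integrable M (\<lambda>\<omega>. \<bar>X \<omega>\<bar> ^ k)"
    and "(CLINT \<omega>|M. iexp (X \<omega>)) = exp (- of_real (\<integral>\<omega>. (X \<omega>)\<^sup>2 \<partial>M) / 2)"
proof -
  interpret prob_space M by fact
  have [measurable]: "X \<in> borel_measurable M" using X(1) by (simp add: gaussian_rv_def)
  obtain \<mu> where "(AE \<omega> in M. X \<omega> = \<mu>) \<or> (\<exists>\<sigma>>0. distributed M lborel X (\<lambda>x. ennreal (normal_density \<mu> \<sigma> x)))"
    using X(1) by (auto simp: gaussian_rv_def)
  then have "integrable M (\<lambda>\<omega>. \<bar>X \<omega>\<bar> ^ k) \<and> (CLINT \<omega>|M. iexp (X \<omega>)) = exp (- of_real (\<integral>\<omega>. (X \<omega>)\<^sup>2 \<partial>M) / 2)"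
  proof (elim disjE exE conjE)
    assume 1: "AE \<omega> in M. X \<omega> = \<mu>"
    then have "(\<integral>\<omega>. X \<omega> \<partial>M) = (\<integral>\<omega>. \<mu> \<partial>M)" by (intro integral_cong_AE) auto
    with X(2) have 0: "AE \<omega> in M. X \<omega> = 0" using 1 by (simp add: prob_space)
    have "integrable M (\<lambda>\<omega>. \<bar>X \<omega>\<bar> ^ k) = integrable M (\<lambda>\<omega>. 0 ^ k :: real)"
      using 0 by (intro integrable_cong_AE) auto
    moreover have "(CLINT \<omega>|M. iexp (X \<omega>)) = (CLINT \<omega>|M. 1)"
      using 0 by (intro integral_cong_AE) auto
    moreover have "(\<integral>\<omega>. (X \<omega>)\<^sup>2 \<partial>M) = (\<integral>\<omega>. 0 \<partial>M)"
      using 0 by (intro integral_cong_AE) auto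
    ultimately show ?thesis by (simp add: prob_space)
  next
    fix \<sigma> :: real
    assume \<sigma>: "0 < \<sigma>" and D: "distributed M lborel X (\<lambda>x. ennreal (normal_density \<mu> \<sigma> x))"
    have \<mu>: "\<mu> = 0" using normal_distributed_expectation[OF \<sigma> D] X(2) by simp
    have var: "(\<integral>\<omega>. (X \<omega>)\<^sup>2 \<partial>M) = \<sigma>\<^sup>2"
      using normal_distributed_variance[OF \<sigma> D] X(2) by simp
    have int: "integrable M (\<lambda>\<omega>. \<bar>X \<omega>\<bar> ^ k)"
      using distributed_integrable[OF D, of "\<lambda>x. \<bar>x\<bar> ^ k"]
        integrable_normal_moment_abs[OF \<sigma>, of \<mu> k] \<mu> by simp
    have "distributed M lborel (\<lambda>x. (X x - \<mu>) / \<sigma>) std_normal_density"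
      using normal_standard_normal_convert[OF \<sigma>, of X \<mu>] D by simp
    then have d: "distr M borel (\<lambda>\<omega>. X \<omega> / \<sigma>) = std_normal_distribution"
      using \<mu> by (auto simp: distributed_def cong: distr_cong)
    have "(CLINT \<omega>|M. iexp (X \<omega>)) = char (distr M borel (\<lambda>\<omega>. X \<omega> / \<sigma>)) \<sigma>"
      unfolding char_def using \<sigma> by (subst integral_distr) auto
    also have "\<dots> = exp (- of_real (\<sigma>\<^sup>2) / 2)"
      unfolding d by (simp add: char_std_normal_distribution exp_of_real[symmetric])
    finally show ?thesis using var int by simp
  qed
  then show "integrable M (\<lambda>\<omega>. \<bar>X \<omega>\<bar> ^ k)" "(CLINT \<omega>|M. iexp (X \<omega>)) = exp (- of_real (\<integral>\<omega>. (X \<omega>)\<^sup>2 \<partial>M) / 2)"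
    by auto
qed

definition quadratic_form :: "'i set \<Rightarrow> ('i \<Rightarrow> 'i \<Rightarrow> real) \<Rightarrow> ('i \<Rightarrow> real) \<Rightarrow> real" where
  "quadratic_form J C a = (\<Sum>i\<in>J. \<Sum>j\<in>J. a i * a j * C i j)"

lemma quadratic_form_scale: "quadratic_form J C (\<lambda>j. c * a j) = c\<^sup>2 * quadratic_form J C a"
  by (simp add: quadratic_form_def sum_distrib_left power2_eq_square ac_simps)

lemma centered_gaussian_process_subset:
  assumes "centered_gaussian_process M I C X" "J \<subseteq> I"
  shows "centered_gaussian_process M J C X"
  using assms unfolding centered_gaussian_process_def gaussian_process_def by (meson subset_eq)

lemma centered_gaussian_process_scale:
  assumes "centered_gaussian_process M I C X"
  shows "centered_gaussian_process M I (\<lambda>s t. c\<^sup>2 * C s t) (\<lambda>t \<omega>. c * X t \<omega>)"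
proof -
  have "gaussian_process M I (\<lambda>t \<omega>. c * X t \<omega>)"
    unfolding gaussian_process_def
  proof (intro conjI ballI allI impI)
    fix J and a :: "'b \<Rightarrow> real" assume J: "finite J \<and> J \<subseteq> I"
    have "gaussian_rv M (\<lambda>\<omega>. \<Sum>t\<in>J. (a t * c) * X t \<omega>)"
      using assms J by (simp only: centered_gaussian_process_def gaussian_process_def)
    then show "gaussian_rv M (\<lambda>\<omega>. \<Sum>t\<in>J. a t * (c * X t \<omega>))" by (simp add: ac_simps)
  qed (use assms in \<open>auto simp: centered_gaussian_process_def gaussian_process_def\<close>)
  moreover have "covariance M (\<lambda>\<omega>. c * U \<omega>) (\<lambda>\<omega>. c * V \<omega>) = c\<^sup>2 * covariance M U V" for U V
  proof -
    have "(c * x - c * y) * (c * x' - c * y') = c\<^sup>2 * ((x - y) * (x' - y'))" for x y x' y' :: real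
      by (simp add: power2_eq_square algebra_simps)
    then show ?thesis unfolding covariance_def integral_mult_right_zero by (simp only: integral_mult_right_zero)
  qed
  ultimately show ?thesis
    using assms by (simp add: centered_gaussian_process_def)
qed

lemma centered_gaussian_process_moments:
  assumes X: "centered_gaussian_process M I C X"
  shows "prob_space M"
    and "\<And>t. t \<in> I \<Longrightarrow> X t \<in> borel_measurable M"
    and "\<And>t k. t \<in> I \<Longrightarrow> integrable M (\<lambda>\<omega>. \<bar>X t \<omega>\<bar> ^ k)"
    and "\<And>t. t \<in> I \<Longrightarrow> integrable M (X t)"
    and "\<And>t. t \<in> I \<Longrightarrow> (\<integral>\<omega>. X t \<omega> \<partial>M) = 0"
    and "\<And>s t. s \<in> I \<Longrightarrow> t \<in> I \<Longrightarrow> integrable M (\<lambda>\<omega>. X s \<omega> * X t \<omega>)"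
    and "\<And>s t. s \<in> I \<Longrightarrow> t \<in> I \<Longrightarrow> (\<integral>\<omega>. X s \<omega> * X t \<omega> \<partial>M) = C s t"
    and "\<And>J a. finite J \<Longrightarrow> J \<subseteq> I \<Longrightarrow> gaussian_rv M (\<lambda>\<omega>. \<Sum>t\<in>J. a t * X t \<omega>)"
proof -
  note X' = X[unfolded centered_gaussian_process_def gaussian_process_def]
  show M: "prob_space M" using X' by blast
  show meas: "X t \<in> borel_measurable M" if "t \<in> I" for t using X' that by blast
  show g: "gaussian_rv M (\<lambda>\<omega>. \<Sum>t\<in>J. a t * X t \<omega>)" if "finite J" "J \<subseteq> I" for J a
    using X' that by blast
  show mean: "(\<integral>\<omega>. X t \<omega> \<partial>M) = 0" if "t \<in> I" for t using X' that by blast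
  have g1: "gaussian_rv M (X t)" if "t \<in> I" for t
    using g[of "{t}" "\<lambda>_. 1"] that by simp
  show int: "integrable M (\<lambda>\<omega>. \<bar>X t \<omega>\<bar> ^ k)" if "t \<in> I" for t k
    by (rule centered_gaussian_rv[OF M g1[OF that] mean[OF that]])
  show "integrable M (X t)" if "t \<in> I" for t
    using int[OF that, of 1] meas[OF that] by (simp add: integrable_abs_iff)
  show "integrable M (\<lambda>\<omega>. X s \<omega> * X t \<omega>)" if st: "s \<in> I" "t \<in> I" for s t
  proof (rule Bochner_Integration.integrable_bound)
    show "integrable M (\<lambda>\<omega>. \<bar>X s \<omega>\<bar>\<^sup>2 + \<bar>X t \<omega>\<bar>\<^sup>2)"
      using int[OF st(1), of 2] int[OF st(2), of 2] by (rule Bochner_Integration.integrable_add)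
    show "AE \<omega> in M. norm (X s \<omega> * X t \<omega>) \<le> norm (\<bar>X s \<omega>\<bar>\<^sup>2 + \<bar>X t \<omega>\<bar>\<^sup>2)"
    proof (rule AE_I2)
      fix \<omega>
      have "2 * \<bar>X s \<omega>\<bar> * \<bar>X t \<omega>\<bar> \<le> \<bar>X s \<omega>\<bar>\<^sup>2 + \<bar>X t \<omega>\<bar>\<^sup>2" by (rule sum_squares_bound)
      moreover have "0 \<le> \<bar>X s \<omega>\<bar> * \<bar>X t \<omega>\<bar>" by simp
      ultimately show "norm (X s \<omega> * X t \<omega>) \<le> norm (\<bar>X s \<omega>\<bar>\<^sup>2 + \<bar>X t \<omega>\<bar>\<^sup>2)"
        unfolding real_norm_def abs_mult by linarith
    qed
  qed (use meas st in auto)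
  show "(\<integral>\<omega>. X s \<omega> * X t \<omega> \<partial>M) = C s t" if "s \<in> I" "t \<in> I" for s t
    using X' that by (simp add: covariance_def mean)
qed

text \<open>The covariance enters the law only through this quadratic form. Equality in law of two
  mixtures of Gaussian vectors thereby becomes an identity between sums of quadratic forms.\<close>

lemma centered_gaussian_process_cf:
  assumes X: "centered_gaussian_process M J C X" and J: "finite J"
  shows "(CLINT \<omega>|M. iexp (\<Sum>j\<in>J. a j * X j \<omega>)) = exp (- of_real (quadratic_form J C a) / 2)"
proof -
  note m = centered_gaussian_process_moments[OF X]
  have "(\<integral>\<omega>. (\<Sum>j\<in>J. a j * X j \<omega>) \<partial>M) = 0"
    using m by (simp add: Bochner_Integration.integral_sum)
  moreover have "(\<integral>\<omega>. (\<Sum>j\<in>J. a j * X j \<omega>)\<^sup>2 \<partial>M) = quadratic_form J C a"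
  proof -
    have "(\<integral>\<omega>. (\<Sum>j\<in>J. a j * X j \<omega>)\<^sup>2 \<partial>M) = (\<integral>\<omega>. (\<Sum>i\<in>J. \<Sum>j\<in>J. a i * a j * (X i \<omega> * X j \<omega>)) \<partial>M)"
      by (simp add: power2_eq_square sum_product ac_simps)
    also have "\<dots> = quadratic_form J C a"
      using m by (simp add: Bochner_Integration.integral_sum quadratic_form_def)
    finally show ?thesis .
  qed
  ultimately show ?thesis
    using centered_gaussian_rv(2)[OF m(1) m(8)[OF J order_refl], of a] by simp
qed

lemma centered_gaussian_process_increment:
  assumes X: "centered_gaussian_process M I C X" and st: "s \<in> I" "t \<in> I"
  shows "integrable M (\<lambda>\<omega>. (X s \<omega> - X t \<omega>)\<^sup>2)"
    and "(\<integral>\<omega>. (X s \<omega> - X t \<omega>)\<^sup>2 \<partial>M) = C s s + C t t - 2 * C s t"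
proof -
  note m = centered_gaussian_process_moments[OF X]
  have eq: "(X s \<omega> - X t \<omega>)\<^sup>2 = X s \<omega> * X s \<omega> + X t \<omega> * X t \<omega> - 2 * (X s \<omega> * X t \<omega>)" for \<omega>
    by (simp add: power2_eq_square algebra_simps)
  show "integrable M (\<lambda>\<omega>. (X s \<omega> - X t \<omega>)\<^sup>2)"
    unfolding eq using m(6) st by auto
  show "(\<integral>\<omega>. (X s \<omega> - X t \<omega>)\<^sup>2 \<partial>M) = C s s + C t t - 2 * C s t"
    unfolding eq using m(6,7) st by simp
qed

text \<open>Independence is realised by the product space: the exponential of the sum factors into a
  function of each component, and Fubini separates the integrals.\<close>

lemma independent_sum_cf:
  fixes X :: "'i \<Rightarrow> 'a \<Rightarrow> real" and Y :: "'i \<Rightarrow> 'b \<Rightarrow> real"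
  assumes M: "prob_space M" "\<And>j. j \<in> J \<Longrightarrow> X j \<in> borel_measurable M"
    and N: "prob_space N" "\<And>j. j \<in> J \<Longrightarrow> Y j \<in> borel_measurable N"
  shows "(CLINT \<omega>|M \<Otimes>\<^sub>M N. iexp (\<Sum>j\<in>J. a j * (\<alpha> * X j (fst \<omega>) + \<beta> * Y j (snd \<omega>)))) =
    (CLINT \<omega>|M. iexp (\<Sum>j\<in>J. (\<alpha> * a j) * X j \<omega>)) * (CLINT \<omega>|N. iexp (\<Sum>j\<in>J. (\<beta> * a j) * Y j \<omega>))"
proof -
  interpret M: prob_space M by fact
  interpret N: prob_space N by fact
  interpret P: pair_prob_space M N ..
  note [measurable] = M(2) N(2)
  have split: "iexp (\<Sum>j\<in>J. a j * (\<alpha> * x j + \<beta> * y j)) = iexp (\<Sum>j\<in>J. (\<alpha> * a j) * x j) * iexp (\<Sum>j\<in>J. (\<beta> * a j) * y j)"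
    for x y
    by (simp add: exp_add[symmetric] distrib_left sum.distrib ac_simps)
  have "(CLINT \<omega>|M \<Otimes>\<^sub>M N. iexp (\<Sum>j\<in>J. a j * (\<alpha> * X j (fst \<omega>) + \<beta> * Y j (snd \<omega>)))) =
     (CLINT x|M. CLINT y|N. iexp (\<Sum>j\<in>J. (\<alpha> * a j) * X j x) * iexp (\<Sum>j\<in>J. (\<beta> * a j) * Y j y))"
    unfolding split
    by (subst P.integral_fst'[symmetric])
       (auto intro!: P.integrable_const_bound[where B=1] simp: norm_mult simp del: of_real_sum of_real_mult)
  then show ?thesis by simp
qed

section \<open>A smooth approximation of the range\<close>

text \<open>As a function of \<open>s\<close>, the logarithm of the sum of
  \<open>w k * exp (s * b k)\<close> is, up to a constant, the cumulant generating function of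
  \<open>b\<close> under the normalised weights. Its third derivative is the third cumulant under
  tilted weights, bounded by \<open>(1 + 3 + 2) * B ^ 3\<close> because normalised moments of order
  \<open>n\<close> are at most \<open>B ^ n\<close>; the 6 cancels the factorial in the
  remainder.\<close>

lemma log_sum_exp_taylor:
  fixes w b :: "'k \<Rightarrow> real"
  assumes K: "finite K" "K \<noteq> {}" and w: "\<And>k. k \<in> K \<Longrightarrow> 0 < w k" and b: "\<And>k. k \<in> K \<Longrightarrow> \<bar>b k\<bar> \<le> B"
  defines "m n \<equiv> (\<Sum>k\<in>K. w k * b k ^ n)"
  shows "\<bar>ln (\<Sum>k\<in>K. w k * exp (b k)) - (ln (m 0) + m 1 / m 0 + (m 2 / m 0 - (m 1 / m 0)\<^sup>2) / 2)\<bar> \<le> B ^ 3"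
proof -
  define S where "S n s = (\<Sum>k\<in>K. w k * b k ^ n * exp (s * b k))" for n s
  have S0: "0 < S 0 s" for s
    unfolding S_def using K w by (intro sum_pos) auto
  have dS: "(S n has_real_derivative S (Suc n) s) (at s)" for n s
    unfolding S_def by (auto intro!: derivative_eq_intros sum.cong)
  have B: "0 \<le> B" using K(2) b by (meson abs_ge_zero ex_in_conv order_trans)
  have SB: "\<bar>S n s / S 0 s\<bar> \<le> B ^ n" for n s
  proof -
    have "\<bar>S n s\<bar> \<le> (\<Sum>k\<in>K. \<bar>w k * b k ^ n * exp (s * b k)\<bar>)" unfolding S_def by (rule sum_abs)
    also have "\<dots> \<le> (\<Sum>k\<in>K. B ^ n * (w k * b k ^ 0 * exp (s * b k)))"
    proof (rule sum_mono)
      fix k assume k: "k \<in> K"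
      have "\<bar>b k\<bar> ^ n * (w k * exp (s * b k)) \<le> B ^ n * (w k * exp (s * b k))"
        using b[OF k] w[OF k] by (intro mult_right_mono power_mono) auto
      then show "\<bar>w k * b k ^ n * exp (s * b k)\<bar> \<le> B ^ n * (w k * b k ^ 0 * exp (s * b k))"
        using w[OF k] by (simp add: abs_mult power_abs ac_simps)
    qed
    also have "\<dots> = B ^ n * S 0 s" by (simp add: S_def sum_distrib_left)
    finally show ?thesis using S0[of s] by (simp only: abs_divide abs_of_pos pos_divide_le_eq)
  qed
  \<comment> \<open>The logarithm itself, followed by the first three cumulants written in terms of
    the moments \<open>S n s / S 0 s\<close>.\<close>
  define diff where "diff n s = (if n = 0 then ln (S 0 s) else if n = 1 then S 1 s / S 0 s
    else if n = 2 then S 2 s / S 0 s - (S 1 s / S 0 s)\<^sup>2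
    else S 3 s / S 0 s - 3 * (S 2 s / S 0 s) * (S 1 s / S 0 s) + 2 * (S 1 s / S 0 s) ^ 3)" for n :: nat and s
  have dS1: "(S 0 has_real_derivative S 1 s) (at s)" "(S 1 has_real_derivative S 2 s) (at s)"
     "(S 2 has_real_derivative S 3 s) (at s)" for s
    using dS[of 0 s] dS[of 1 s] dS[of 2 s] by (simp_all only: One_nat_def numeral_2_eq_2 numeral_3_eq_3)
  have dd: "(diff n has_real_derivative diff (Suc n) s) (at s)" if n: "n < 3" for n s
  proof -
    have S0': "S 0 s \<noteq> 0" using S0[of s] by simp
    consider "n = 0" | "n = 1" | "n = 2" using n by linarith
    then show ?thesis
    proof cases
      case 1
      then show ?thesis unfolding diff_def using S0[of s]
        by (auto intro!: derivative_eq_intros dS1)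
    next
      case 2
      then show ?thesis unfolding diff_def using S0'
        by (auto intro!: derivative_eq_intros dS1 dS1(2)[unfolded One_nat_def] simp: power2_eq_square field_simps)
    next
      case 3
      then show ?thesis unfolding diff_def using S0'
        by (auto intro!: derivative_eq_intros dS1 dS1(2)[unfolded One_nat_def] simp: power2_eq_square power3_eq_cube field_simps)
    qed
  qed
  obtain t where t: "diff 0 1 = (\<Sum>m<3. diff m 0 / fact m * 1 ^ m) + diff 3 t / fact 3 * 1 ^ 3"
    using Maclaurin[of 1 3 diff "diff 0"] dd by auto
  have tri: "\<bar>p - 3 * q * r + 2 * r ^ 3\<bar> \<le> \<bar>p\<bar> + 3 * \<bar>q\<bar> * \<bar>r\<bar> + 2 * \<bar>r\<bar> ^ 3" for p q r :: real
  proof -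
    have "\<bar>3 * q * r\<bar> = 3 * \<bar>q\<bar> * \<bar>r\<bar>" "\<bar>2 * r ^ 3\<bar> = 2 * \<bar>r\<bar> ^ 3"
      by (simp_all add: abs_mult power_abs)
    then show ?thesis by linarith
  qed
  have "\<bar>diff 3 t\<bar> \<le> \<bar>S 3 t / S 0 t\<bar> + 3 * \<bar>S 2 t / S 0 t\<bar> * \<bar>S 1 t / S 0 t\<bar> + 2 * \<bar>S 1 t / S 0 t\<bar> ^ 3"
    using tri[of "S 3 t / S 0 t" "S 2 t / S 0 t" "S 1 t / S 0 t"] by (simp only: diff_def) simp
  also have "\<dots> \<le> B ^ 3 + 3 * B\<^sup>2 * B ^ 1 + 2 * (B ^ 1) ^ 3"
    by (intro add_mono mult_mono power_mono SB mult_nonneg_nonneg zero_le_power abs_ge_zero B order_refl) auto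
  also have "\<dots> = 6 * B ^ 3" by (simp add: power2_eq_square power3_eq_cube)
  finally have *: "\<bar>diff 3 t / fact 3\<bar> \<le> B ^ 3" by (simp add: fact_numeral)
  have "diff 0 1 = ln (\<Sum>k\<in>K. w k * exp (b k))" by (simp add: diff_def S_def)
  moreover have "(\<Sum>m<3. diff m 0 / fact m * 1 ^ m) = ln (m 0) + m 1 / m 0 + (m 2 / m 0 - (m 1 / m 0)\<^sup>2) / 2"
    by (simp add: diff_def S_def m_def eval_nat_numeral)
  ultimately have "ln (\<Sum>k\<in>K. w k * exp (b k)) - (ln (m 0) + m 1 / m 0 + (m 2 / m 0 - (m 1 / m 0)\<^sup>2) / 2) = diff 3 t / fact 3"
    using t by simp
  then show ?thesis using * by (simp only:)
qed

text \<open>For \<open>c = exp a\<close> this approximates \<open>max (max_range J x) a\<close>; putting the cut-off \<open>a\<close> into the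
  weights of the diagonal pairs keeps it a log-sum-exp of differences \<open>x i - x j\<close> only.\<close>

definition soft_range :: "'i set \<Rightarrow> real \<Rightarrow> ('i \<Rightarrow> real) \<Rightarrow> real" where
  "soft_range J c x = ln (\<Sum>(i, j)\<in>J \<times> J. (if i = j then 1 + c else 1) * exp (x i - x j))"

definition max_range :: "'i set \<Rightarrow> ('i \<Rightarrow> real) \<Rightarrow> real" where
  "max_range J x = Max ((\<lambda>(i, j). x i - x j) ` (J \<times> J))"

text \<open>Without the cut-off the weight of a pair \<open>(i, j)\<close> is a product of a
  function of \<open>i\<close> and a function of \<open>j\<close>. The diagonal adds
  \<open>c\<close> for each index, since \<open>exp (x i - x i) = 1\<close>.\<close>

lemma soft_range_sum:
  assumes "finite J"
  shows "(\<Sum>(i, j)\<in>J \<times> J. (if i = j then 1 + c else 1) * exp (x i - x j)) =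
     (\<Sum>i\<in>J. exp (x i)) * (\<Sum>j\<in>J. exp (- x j)) + of_nat (card J) * (c :: real)"
proof -
  have "(\<Sum>(i, j)\<in>J \<times> J. (if i = j then 1 + c else 1) * exp (x i - x j)) =
    (\<Sum>i\<in>J. \<Sum>j\<in>J. exp (x i) * exp (- x j) + (if i = j then c else 0))"
    unfolding sum.cartesian_product
    by (rule sum.cong) (auto simp: exp_add[symmetric] exp_minus[symmetric] distrib_right)
  also have "\<dots> = (\<Sum>i\<in>J. exp (x i)) * (\<Sum>j\<in>J. exp (- x j)) + of_nat (card J) * c"
    using assms by (simp add: sum.distrib sum_product)
  finally show ?thesis .
qed

text \<open>The point is that the second derivative is a nonnegative combination of the squares
  \<open>(y i - y j)\<^sup>2\<close>, so that only the variances of increments enter.\<close>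

lemma soft_range_expansion:
  fixes J :: "'i set"
  assumes J: "finite J" "J \<noteq> {}" and c: "0 \<le> c"
  obtains g h where "\<forall>i j. 0 \<le> h i j"
    and "\<forall>r y. 0 \<le> r \<longrightarrow> \<bar>soft_range J c (\<lambda>j. v j + r * y j) - (soft_range J c v
        + r * (\<Sum>i\<in>J. \<Sum>j\<in>J. g i j * (y i - y j)) + r\<^sup>2 / 2 * (\<Sum>i\<in>J. \<Sum>j\<in>J. h i j * (y i - y j)\<^sup>2))\<bar>
      \<le> 8 * r ^ 3 * (\<Sum>j\<in>J. \<bar>y j\<bar>) ^ 3"
proof -
  define a where "a j = exp (v j)" for j
  define b where "b j = exp (- v j)" for j
  define A where "A = (\<Sum>j\<in>J. a j)"
  define B where "B = (\<Sum>j\<in>J. b j)"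
  define \<kappa> where "\<kappa> = of_nat (card J) * c"
  define S where "S = A * B + \<kappa>"
  define w where "w = (\<lambda>(i, j). (if i = j then 1 + c else 1) * exp (v i - v j))"
  have pos: "0 < a j" "0 < b j" for j by (auto simp: a_def b_def)
  have AB: "0 < A" "0 < B" unfolding A_def B_def using J pos by (auto intro: sum_pos)
  have \<kappa>: "0 \<le> \<kappa>" using c by (simp add: \<kappa>_def)
  have S: "0 < S" using AB \<kappa> unfolding S_def by (simp add: add_pos_nonneg)
  have w0: "sum w (J \<times> J) = S"
    using soft_range_sum[OF J(1), of c v] by (simp add: w_def S_def A_def B_def a_def b_def \<kappa>_def)
  \<comment> \<open>For positive order the diagonal terms vanish, so the cut-off influences the
    moments only through the normalisation \<open>S\<close>.\<close>
  have wn: "(\<Sum>(i, j)\<in>J \<times> J. w (i, j) * (y i - y j) ^ n) = (\<Sum>i\<in>J. \<Sum>j\<in>J. a i * b j * (y i - y j) ^ n)"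
    if "0 < n" for n y
    unfolding sum.cartesian_product using that
    by (intro sum.cong) (auto simp: w_def a_def b_def exp_add[symmetric] power_0_left)
  define g where "g i j = a i * b j / S" for i j
  \<comment> \<open>For \<open>\<kappa> = 0\<close> the indices \<open>i\<close> and
    \<open>j\<close> are independent with laws \<open>a / A\<close> and \<open>b / B\<close>. The
    variance of \<open>y i - y j\<close> is then the sum of two variances, each being half the mean
    of \<open>(y i - y j)\<^sup>2\<close> over two independent indices with the same law. A positive
    \<open>\<kappa>\<close> leaves the excess \<open>\<kappa> / S\<^sup>2\<close> times the second
    moment sum, which is already a combination of squares.\<close>
  define h where "h i j = ((B\<^sup>2 * (a i * a j) + A\<^sup>2 * (b i * b j)) / 2 + \<kappa> * (a i * b j)) / S\<^sup>2" for i j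
  have hess: "(\<Sum>i\<in>J. \<Sum>j\<in>J. a i * b j * (y i - y j)\<^sup>2) / S - ((\<Sum>i\<in>J. \<Sum>j\<in>J. a i * b j * (y i - y j)) / S)\<^sup>2
     = (\<Sum>i\<in>J. \<Sum>j\<in>J. h i j * (y i - y j)\<^sup>2)" for y
  proof -
    define A1 A2 B1 B2 where "A1 = (\<Sum>j\<in>J. a j * y j)" and "A2 = (\<Sum>j\<in>J. a j * (y j)\<^sup>2)"
      and "B1 = (\<Sum>j\<in>J. b j * y j)" and "B2 = (\<Sum>j\<in>J. b j * (y j)\<^sup>2)"
    have sq: "(\<Sum>i\<in>J. \<Sum>j\<in>J. f i * f' j * (y i - y j)\<^sup>2) =
        (\<Sum>j\<in>J. f j * (y j)\<^sup>2) * sum f' J + sum f J * (\<Sum>j\<in>J. f' j * (y j)\<^sup>2)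
        - 2 * ((\<Sum>j\<in>J. f j * y j) * (\<Sum>j\<in>J. f' j * y j))" for f f'
    proof -
      have "f i * f' j * (y i - y j)\<^sup>2 = f i * (y i)\<^sup>2 * f' j + f i * (f' j * (y j)\<^sup>2) - 2 * (f i * y i * (f' j * y j))" for i j
        by (simp add: power2_eq_square algebra_simps)
      then show ?thesis
        unfolding sum_product by (simp only: sum.distrib sum_subtractf sum_distrib_left)
    qed
    have "a i * b j * (y i - y j) = a i * y i * b j - a i * (b j * y j)" for i j
      by (simp add: algebra_simps)
    then have lin: "(\<Sum>i\<in>J. \<Sum>j\<in>J. a i * b j * (y i - y j)) = A1 * B - A * B1"
      unfolding A1_def B1_def A_def B_def sum_product by (simp only: sum_subtractf)
    have "(\<Sum>i\<in>J. \<Sum>j\<in>J. h i j * (y i - y j)\<^sup>2) =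
      (B\<^sup>2 * (\<Sum>i\<in>J. \<Sum>j\<in>J. a i * a j * (y i - y j)\<^sup>2) / 2 + A\<^sup>2 * (\<Sum>i\<in>J. \<Sum>j\<in>J. b i * b j * (y i - y j)\<^sup>2) / 2
        + \<kappa> * (\<Sum>i\<in>J. \<Sum>j\<in>J. a i * b j * (y i - y j)\<^sup>2)) / S\<^sup>2"
    proof -
      have "h i j * (y i - y j)\<^sup>2 = (B\<^sup>2 * (a i * a j * (y i - y j)\<^sup>2) / 2 + A\<^sup>2 * (b i * b j * (y i - y j)\<^sup>2) / 2
        + \<kappa> * (a i * b j * (y i - y j)\<^sup>2)) / S\<^sup>2" for i j
        by (simp add: h_def add_divide_distrib algebra_simps)
      then show ?thesis by (simp only: sum.distrib add_divide_distrib sum_distrib_left sum_divide_distrib)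
    qed
    also have "\<dots> = (B\<^sup>2 * (A2 * A - A1\<^sup>2) + A\<^sup>2 * (B2 * B - B1\<^sup>2) + \<kappa> * (A2 * B + A * B2 - 2 * A1 * B1)) / S\<^sup>2"
      unfolding sq by (simp add: A_def B_def A1_def A2_def B1_def B2_def power2_eq_square
          algebra_simps add_divide_distrib diff_divide_distrib)
    also have "B\<^sup>2 * (A2 * A - A1\<^sup>2) + A\<^sup>2 * (B2 * B - B1\<^sup>2) + \<kappa> * (A2 * B + A * B2 - 2 * A1 * B1)
       = S * (A2 * B + A * B2 - 2 * A1 * B1) - (A1 * B - A * B1)\<^sup>2"
      unfolding S_def by (simp add: power2_eq_square algebra_simps)
    also have "\<dots> / S\<^sup>2 = (A2 * B + A * B2 - 2 * A1 * B1) / S - ((A1 * B - A * B1) / S)\<^sup>2"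
      using S by (simp add: field_simps power2_eq_square)
    finally show ?thesis
      unfolding sq lin by (simp add: A_def B_def A1_def A2_def B1_def B2_def)
  qed
  have "0 \<le> h i j" for i j
    using pos[of i] pos[of j] \<kappa> by (simp add: h_def)
  moreover have "\<bar>soft_range J c (\<lambda>j. v j + r * y j) - (soft_range J c v
        + r * (\<Sum>i\<in>J. \<Sum>j\<in>J. g i j * (y i - y j)) + r\<^sup>2 / 2 * (\<Sum>i\<in>J. \<Sum>j\<in>J. h i j * (y i - y j)\<^sup>2))\<bar>
      \<le> 8 * r ^ 3 * (\<Sum>j\<in>J. \<bar>y j\<bar>) ^ 3" if r: "0 \<le> r" for r y
  proof -
    define \<beta> where "\<beta> = (\<lambda>(i, j). r * (y i - y j))"
    define Y where "Y = (\<Sum>j\<in>J. \<bar>y j\<bar>)"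
    define m where "m n = (\<Sum>k\<in>J \<times> J. w k * \<beta> k ^ n)" for n
    have yY: "\<bar>y i\<bar> \<le> Y" if "i \<in> J" for i
      unfolding Y_def using J that by (intro member_le_sum) auto
    \<comment> \<open>The cube of this bound is the source of the constant 8 in the
      remainder.\<close>
    have bound: "\<bar>\<beta> k\<bar> \<le> 2 * r * Y" if kJ: "k \<in> J \<times> J" for k
    proof -
      obtain i j where k: "k = (i, j)" "i \<in> J" "j \<in> J" using kJ by auto
      have "\<bar>y i - y j\<bar> \<le> 2 * Y" using yY[OF k(2)] yY[OF k(3)] by linarith
      then have "r * \<bar>y i - y j\<bar> \<le> r * (2 * Y)" using r by (rule mult_left_mono)
      then show ?thesis using r by (simp add: \<beta>_def k abs_mult)
    qed
    have wpos: "0 < w k" if "k \<in> J \<times> J" for k using c by (auto simp: w_def split: prod.splits)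
    have m0: "m 0 = S" using w0 by (simp add: m_def)
    have mn: "m n = r ^ n * (\<Sum>i\<in>J. \<Sum>j\<in>J. a i * b j * (y i - y j) ^ n)" if "0 < n" for n
      unfolding m_def wn[OF that, symmetric] sum_distrib_left
      by (rule sum.cong) (auto simp: \<beta>_def power_mult_distrib)
    have "\<bar>ln (\<Sum>k\<in>J \<times> J. w k * exp (\<beta> k)) - (ln (m 0) + m 1 / m 0 + (m 2 / m 0 - (m 1 / m 0)\<^sup>2) / 2)\<bar> \<le> (2 * r * Y) ^ 3"
      unfolding m_def using J bound wpos by (intro log_sum_exp_taylor) auto
    moreover have "(\<Sum>k\<in>J \<times> J. w k * exp (\<beta> k)) =
        (\<Sum>(i, j)\<in>J \<times> J. (if i = j then 1 + c else 1) * exp (v i + r * y i - (v j + r * y j)))"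
      by (intro sum.cong) (auto simp: w_def \<beta>_def exp_add[symmetric] algebra_simps)
    then have "ln (\<Sum>k\<in>J \<times> J. w k * exp (\<beta> k)) = soft_range J c (\<lambda>j. v j + r * y j)"
      by (simp add: soft_range_def)
    moreover have "ln (m 0) = soft_range J c v"
      unfolding m0 w0[symmetric] by (simp add: soft_range_def w_def)
    moreover have "m 1 / m 0 = r * (\<Sum>i\<in>J. \<Sum>j\<in>J. g i j * (y i - y j))"
      proof -
      have "(\<Sum>i\<in>J. \<Sum>j\<in>J. g i j * (y i - y j)) = (\<Sum>i\<in>J. \<Sum>j\<in>J. a i * b j * (y i - y j)) / S"
        by (simp add: g_def sum_divide_distrib)
      then show ?thesis unfolding m0 using mn[of 1] by simp
    qed
    moreover have "m 2 / m 0 - (m 1 / m 0)\<^sup>2 = r\<^sup>2 * (\<Sum>i\<in>J. \<Sum>j\<in>J. h i j * (y i - y j)\<^sup>2)"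
      unfolding hess[symmetric] m0 using mn[of 1] mn[of 2]
      by (simp add: power_mult_distrib power_divide right_diff_distrib)
    ultimately show ?thesis by (simp add: Y_def power_mult_distrib)
  qed
  ultimately show thesis by (intro that[of h g]) blast+
qed

section \<open>Bounds for the range over a finite set\<close>

lemma max_range_ge: "finite J \<Longrightarrow> i \<in> J \<Longrightarrow> j \<in> J \<Longrightarrow> x i - x j \<le> max_range J x"
  unfolding max_range_def by (intro Max_ge) (auto intro!: image_eqI[where x="(i, j)"])

lemma max_range_attained:
  assumes "finite J" "J \<noteq> {}"
  obtains i j where "i \<in> J" "j \<in> J" "max_range J x = x i - x j"
proof -
  have "max_range J x \<in> (\<lambda>(i, j). x i - x j) ` (J \<times> J)"
    unfolding max_range_def using assms by (intro Max_in) auto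
  then show ?thesis using that by auto
qed

lemma max_range_nonneg: "finite J \<Longrightarrow> J \<noteq> {} \<Longrightarrow> 0 \<le> max_range J x"
  using max_range_ge[of J _ _ x] by (metis diff_self ex_in_conv)

lemma max_range_le_sum:
  assumes "finite J" "J \<noteq> {}"
  shows "max_range J x \<le> 2 * (\<Sum>j\<in>J. \<bar>x j\<bar>)"
proof -
  obtain i j where ij: "i \<in> J" "j \<in> J" "max_range J x = x i - x j"
    using max_range_attained[OF assms] .
  have "\<bar>x i\<bar> \<le> (\<Sum>j\<in>J. \<bar>x j\<bar>)" "\<bar>x j\<bar> \<le> (\<Sum>j\<in>J. \<bar>x j\<bar>)"
    using ij assms by (auto intro!: member_le_sum[where f="\<lambda>j. \<bar>x j\<bar>"])
  then show ?thesis using ij(3) by linarith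
qed

lemma max_range_scale:
  assumes "finite J" "J \<noteq> {}" "0 \<le> c"
  shows "max_range J (\<lambda>j. c * x j) = c * max_range J x"
proof -
  obtain i j where ij: "i \<in> J" "j \<in> J" "max_range J x = x i - x j"
    using max_range_attained[OF assms(1,2)] .
  obtain k l where kl: "k \<in> J" "l \<in> J" "max_range J (\<lambda>j. c * x j) = c * x k - c * x l"
    using max_range_attained[OF assms(1,2)] .
  have "c * (x k - x l) \<le> c * max_range J x"
    using max_range_ge[OF assms(1) kl(1,2)] assms(3) by (rule mult_left_mono)
  moreover have "c * x i - c * x j \<le> max_range J (\<lambda>j. c * x j)"
    by (rule max_range_ge[OF assms(1) ij(1,2)])
  ultimately show ?thesis using ij kl by (simp add: right_diff_distrib)
qed

text \<open>The argument of the logarithm consists of \<open>n\<^sup>2\<close> terms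
  \<open>exp (x i - x j)\<close> and \<open>n\<close> terms \<open>exp a\<close>. It is at least the
  largest of them and at most \<open>n\<^sup>2 + n\<close> times the largest.\<close>

lemma soft_range_bounds:
  fixes a :: real
  assumes J: "finite J" "J \<noteq> {}"
  defines "n \<equiv> real (card J)"
  shows "max (max_range J x) a \<le> soft_range J (exp a) x"
    and "soft_range J (exp a) x \<le> max (max_range J x) a + ln (n\<^sup>2 + n)"
proof -
  define m where "m = max (max_range J x) a"
  have n: "1 \<le> n" using J by (simp add: n_def Suc_le_eq card_gt_0_iff)
  define S where "S = (\<Sum>(i, j)\<in>J \<times> J. exp (x i - x j))"
  have S: "(\<Sum>(i, j)\<in>J \<times> J. (if i = j then 1 + exp a else 1) * exp (x i - x j)) = S + n * exp a"
    unfolding soft_range_sum[OF J(1)] S_def n_def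
    by (simp add: sum_product sum.cartesian_product exp_add[symmetric])
  obtain i j where ij: "i \<in> J" "j \<in> J" "max_range J x = x i - x j"
    using max_range_attained[OF J] .
  have "(case (i, j) of (i, j) \<Rightarrow> exp (x i - x j)) \<le> S"
    unfolding S_def using J ij by (intro member_le_sum) auto
  then have "exp (max_range J x) \<le> S" using ij by simp
  moreover have "exp a \<le> n * exp a" using n by simp
  moreover have "0 < exp (max_range J x)" "0 < exp a" by auto
  ultimately have "exp (max_range J x) \<le> S + n * exp a" "exp a \<le> S + n * exp a" by linarith+
  then have le: "exp m \<le> S + n * exp a" by (simp add: m_def max_def)
  then have pos: "0 < S + n * exp a" using exp_gt_zero[of m] by linarith
  show "max (max_range J x) a \<le> soft_range J (exp a) x"
    unfolding soft_range_def S m_def[symmetric] using le pos by (simp add: ln_ge_iff)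
  have "S \<le> (\<Sum>(i, j)\<in>J \<times> J. exp m)"
    unfolding S_def
  proof (intro sum_mono, clarsimp)
    fix i j assume "i \<in> J" "j \<in> J"
    then show "x i - x j \<le> m" using max_range_ge[OF J(1), of i j x] by (simp add: m_def le_max_iff_disj)
  qed
  also have "\<dots> = n\<^sup>2 * exp m" by (simp add: n_def card_cartesian_product power2_eq_square)
  finally have "S \<le> n\<^sup>2 * exp m" .
  moreover have "n * exp a \<le> n * exp m" using n by (simp add: m_def)
  ultimately have "S + n * exp a \<le> (n\<^sup>2 + n) * exp m" by (simp add: distrib_right)
  moreover have "0 < n\<^sup>2 + n" using n by (simp add: add_pos_pos)
  ultimately have "ln (S + n * exp a) \<le> ln ((n\<^sup>2 + n) * exp m)" using pos by simp
  also have "\<dots> = m + ln (n\<^sup>2 + n)" using \<open>0 < n\<^sup>2 + n\<close> by (simp add: ln_mult)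
  finally show "soft_range J (exp a) x \<le> max (max_range J x) a + ln (n\<^sup>2 + n)"
    unfolding soft_range_def S m_def .
qed

section \<open>Comparison of Gaussian vectors\<close>

lemma integrable_comp_fst:
  fixes f :: "'a \<Rightarrow> real"
  assumes "prob_space N" "integrable M f"
  shows "integrable (M \<Otimes>\<^sub>M N) (\<lambda>p. f (fst p))"
proof -
  have "integrable (distr (M \<Otimes>\<^sub>M N) M fst) f"
    using assms by (simp add: prob_space.distr_pair_fst)
  then show ?thesis using assms(2) by (subst (asm) integrable_distr_eq) auto
qed

lemma integrable_comp_snd:
  fixes f :: "'b \<Rightarrow> real"
  assumes "prob_space M" "prob_space N" "integrable N f"
  shows "integrable (M \<Otimes>\<^sub>M N) (\<lambda>p. f (snd p))"
proof -
  interpret pair_prob_space N M using assms by (simp add: pair_prob_space_def pair_sigma_finite_def prob_space_imp_sigma_finite)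
  show ?thesis
    using integrable_product_swap[OF integrable_comp_fst[OF assms(1,3)]] by (simp add: case_prod_beta')
qed

lemma soft_range_restrict: "soft_range J c (restrict x J) = soft_range J c x"
  unfolding soft_range_def by (intro arg_cong[where f=ln] sum.cong) auto

lemma soft_range_measurable[measurable]: "soft_range J c \<in> borel_measurable (\<Pi>\<^sub>M j\<in>J. borel)"
  unfolding soft_range_def case_prod_beta
  by (intro borel_measurable_ln borel_measurable_sum borel_measurable_times borel_measurable_const
      borel_measurable_exp borel_measurable_diff measurable_component_singleton) auto

lemma max_range_measurable:
  assumes "finite J" "\<And>j. j \<in> J \<Longrightarrow> X j \<in> borel_measurable M"
  shows "(\<lambda>\<omega>. max_range J (\<lambda>j. X j \<omega>)) \<in> borel_measurable M"
proof -
  have "(\<lambda>\<omega>. Max ((\<lambda>k. X (fst k) \<omega> - X (snd k) \<omega>) ` (J \<times> J))) \<in> borel_measurable M"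
    using assms by (intro borel_measurable_Max borel_measurable_diff) auto
  then show ?thesis by (simp add: max_range_def case_prod_beta')
qed

lemma max_range_integrable:
  assumes "prob_space M" "finite J" "J \<noteq> {}" "\<And>j. j \<in> J \<Longrightarrow> integrable M (X j)"
  shows "integrable M (\<lambda>\<omega>. max_range J (\<lambda>j. X j \<omega>))"
proof (rule Bochner_Integration.integrable_bound)
  show "integrable M (\<lambda>\<omega>. 2 * (\<Sum>j\<in>J. \<bar>X j \<omega>\<bar>))" using assms by auto
  show "(\<lambda>\<omega>. max_range J (\<lambda>j. X j \<omega>)) \<in> borel_measurable M"
    using assms by (intro max_range_measurable) auto
  show "AE \<omega> in M. norm (max_range J (\<lambda>j. X j \<omega>)) \<le> norm (2 * (\<Sum>j\<in>J. \<bar>X j \<omega>\<bar>))"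
  proof (rule AE_I2)
    fix \<omega>
    show "norm (max_range J (\<lambda>j. X j \<omega>)) \<le> norm (2 * (\<Sum>j\<in>J. \<bar>X j \<omega>\<bar>))"
      using max_range_nonneg[OF assms(2,3), where x="\<lambda>j. X j \<omega>"] max_range_le_sum[OF assms(2,3), where x="\<lambda>j. X j \<omega>"]
      by simp
  qed
qed

lemma soft_range_integrable:
  assumes M: "prob_space M" and J: "finite J" "J \<noteq> {}" and X: "\<And>j. j \<in> J \<Longrightarrow> integrable M (X j)"
  shows "integrable M (\<lambda>\<omega>. soft_range J (exp a) (\<lambda>j. X j \<omega>))"
proof -
  interpret prob_space M by fact
  define L where "L = ln ((real (card J))\<^sup>2 + real (card J))"
  let ?R = "\<lambda>\<omega>. max_range J (\<lambda>j. X j \<omega>)"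
  have int: "integrable M ?R" by (rule max_range_integrable[OF M J X])
  have meas: "(\<lambda>\<omega>. soft_range J (exp a) (\<lambda>j\<in>J. X j \<omega>)) \<in> borel_measurable M"
    by (rule measurable_compose[OF _ soft_range_measurable]) (use X in \<open>auto intro!: measurable_restrict\<close>)
  show ?thesis
  proof (rule Bochner_Integration.integrable_bound)
    show "integrable M (\<lambda>\<omega>. ?R \<omega> + \<bar>a\<bar> + \<bar>L\<bar>)" using int by auto
    show "AE \<omega> in M. norm (soft_range J (exp a) (\<lambda>j. X j \<omega>)) \<le> norm (?R \<omega> + \<bar>a\<bar> + \<bar>L\<bar>)"
    proof (rule AE_I2)
      fix \<omega>
      show "norm (soft_range J (exp a) (\<lambda>j. X j \<omega>)) \<le> norm (?R \<omega> + \<bar>a\<bar> + \<bar>L\<bar>)"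
        using soft_range_bounds[OF J, where x="\<lambda>j. X j \<omega>" and a=a] max_range_nonneg[OF J, where x="\<lambda>j. X j \<omega>"]
        unfolding L_def[symmetric] real_norm_def by linarith
    qed
  qed (use meas in \<open>simp add: soft_range_restrict\<close>)
qed

text \<open>Points of the product space are \<open>undefined\<close> outside \<open>J\<close>,
  whereas the families \<open>X\<close> and \<open>X'\<close> are not. The condition on
  \<open>restrict\<close> says that \<open>F\<close> does not see this difference.\<close>

lemma joint_cf_integral_eq:
  fixes X :: "'i \<Rightarrow> 'a \<Rightarrow> real" and X' :: "'i \<Rightarrow> 'b \<Rightarrow> real" and F :: "('i \<Rightarrow> real) \<Rightarrow> real"
  assumes M: "prob_space M" "\<And>j. j \<in> J \<Longrightarrow> X j \<in> borel_measurable M"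
    and M': "prob_space M'" "\<And>j. j \<in> J \<Longrightarrow> X' j \<in> borel_measurable M'"
    and J: "finite J"
    and eq: "\<And>a. (CLINT \<omega>|M. iexp (\<Sum>j\<in>J. a j * X j \<omega>)) = (CLINT \<omega>|M'. iexp (\<Sum>j\<in>J. a j * X' j \<omega>))"
    and F: "F \<in> borel_measurable (\<Pi>\<^sub>M j\<in>J. borel)" "\<And>x. F (restrict x J) = F x"
  shows "(\<integral>\<omega>. F (\<lambda>j. X j \<omega>) \<partial>M) = (\<integral>\<omega>. F (\<lambda>j. X' j \<omega>) \<partial>M')"
proof -
  have "(\<integral>\<omega>. F (\<lambda>j. X j \<omega>) \<partial>M) = (\<integral>x. F x \<partial>distr M (\<Pi>\<^sub>M j\<in>J. borel) (\<lambda>\<omega>. \<lambda>j\<in>J. X j \<omega>))"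
    using M F by (subst integral_distr) (auto intro!: measurable_restrict)
  also have "distr M (\<Pi>\<^sub>M j\<in>J. borel) (\<lambda>\<omega>. \<lambda>j\<in>J. X j \<omega>) = distr M' (\<Pi>\<^sub>M j\<in>J. borel) (\<lambda>\<omega>. \<lambda>j\<in>J. X' j \<omega>)"
    by (rule joint_cf_unique[OF M M' J eq])
  also have "(\<integral>x. F x \<partial>distr M' (\<Pi>\<^sub>M j\<in>J. borel) (\<lambda>\<omega>. \<lambda>j\<in>J. X' j \<omega>)) = (\<integral>\<omega>. F (\<lambda>j. X' j \<omega>) \<partial>M')"
    using M' F by (subst integral_distr) (auto intro!: measurable_restrict)
  finally show ?thesis .
qed

text \<open>The sum is at most \<open>n\<close> times its largest term, and the cube of the largest
  term is at most the sum of the cubes.\<close>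

lemma integrable_sum_abs_cube:
  assumes X: "centered_gaussian_process M J C X" and J: "finite J" "J \<noteq> {}"
  shows "integrable M (\<lambda>\<omega>. (\<Sum>j\<in>J. \<bar>X j \<omega>\<bar>) ^ 3)"
proof (rule Bochner_Integration.integrable_bound)
  note m = centered_gaussian_process_moments[OF X]
  define n where "n = real (card J)"
  show "integrable M (\<lambda>\<omega>. n ^ 3 * (\<Sum>j\<in>J. \<bar>X j \<omega>\<bar> ^ 3))" using m by auto
  show "(\<lambda>\<omega>. (\<Sum>j\<in>J. \<bar>X j \<omega>\<bar>) ^ 3) \<in> borel_measurable M" using m by auto
  show "AE \<omega> in M. norm ((\<Sum>j\<in>J. \<bar>X j \<omega>\<bar>) ^ 3) \<le> norm (n ^ 3 * (\<Sum>j\<in>J. \<bar>X j \<omega>\<bar> ^ 3))"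
  proof (rule AE_I2)
    fix \<omega>
    obtain k where k: "k \<in> J" "\<And>j. j \<in> J \<Longrightarrow> \<bar>X j \<omega>\<bar> \<le> \<bar>X k \<omega>\<bar>"
      using J Max_in[of "(\<lambda>j. \<bar>X j \<omega>\<bar>) ` J"] Max_ge[of "(\<lambda>j. \<bar>X j \<omega>\<bar>) ` J"] by fastforce
    have "(\<Sum>j\<in>J. \<bar>X j \<omega>\<bar>) \<le> n * \<bar>X k \<omega>\<bar>"
      unfolding n_def using k(2) by (rule sum_bounded_above)
    then have "(\<Sum>j\<in>J. \<bar>X j \<omega>\<bar>) ^ 3 \<le> (n * \<bar>X k \<omega>\<bar>) ^ 3"
      by (intro power_mono) (auto intro: sum_nonneg)
    also have "\<dots> = n ^ 3 * \<bar>X k \<omega>\<bar> ^ 3" by (rule power_mult_distrib)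
    also have "\<dots> \<le> n ^ 3 * (\<Sum>j\<in>J. \<bar>X j \<omega>\<bar> ^ 3)"
      using J k(1) by (intro mult_left_mono member_le_sum) (auto simp: n_def)
    finally have "(\<Sum>j\<in>J. \<bar>X j \<omega>\<bar>) ^ 3 \<le> n ^ 3 * (\<Sum>j\<in>J. \<bar>X j \<omega>\<bar> ^ 3)" .
    moreover have "0 \<le> (\<Sum>j\<in>J. \<bar>X j \<omega>\<bar>) ^ 3" by (intro zero_le_power sum_nonneg) auto
    ultimately show "norm ((\<Sum>j\<in>J. \<bar>X j \<omega>\<bar>) ^ 3) \<le> norm (n ^ 3 * (\<Sum>j\<in>J. \<bar>X j \<omega>\<bar> ^ 3))"
      by simp
  qed
qed

text \<open>In the expansion at \<open>v\<close> the linear term has mean zero, and the quadratic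
  term has as mean a combination of increment variances with the nonnegative coefficients
  \<open>h\<close>, which \<open>le\<close> compares term by term. The constant comes from third
  absolute moments alone and is thus uniform in \<open>v\<close>, so a random vector may be
  substituted for \<open>v\<close> later.\<close>

lemma soft_range_gaussian_step:
  assumes X: "centered_gaussian_process M J C X" and Y: "centered_gaussian_process N J D Y"
    and J: "finite J" "J \<noteq> {}"
    and le: "\<And>i j. i \<in> J \<Longrightarrow> j \<in> J \<Longrightarrow> C i i + C j j - 2 * C i j \<le> D i i + D j j - 2 * D i j"
  shows "\<exists>\<kappa>. \<forall>v r. 0 \<le> r \<longrightarrow>
    (\<integral>\<omega>. soft_range J (exp a) (\<lambda>j. v j + r * X j \<omega>) \<partial>M)
      \<le> (\<integral>\<omega>. soft_range J (exp a) (\<lambda>j. v j + r * Y j \<omega>) \<partial>N) + \<kappa> * r ^ 3"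
proof (intro exI[of _ "8 * (\<integral>\<omega>. (\<Sum>j\<in>J. \<bar>X j \<omega>\<bar>) ^ 3 \<partial>M) + 8 * (\<integral>\<omega>. (\<Sum>j\<in>J. \<bar>Y j \<omega>\<bar>) ^ 3 \<partial>N)"] allI impI)
  fix v :: "'b \<Rightarrow> real" and r :: real assume r: "0 \<le> r"
  note mX = centered_gaussian_process_moments[OF X] and mY = centered_gaussian_process_moments[OF Y]
  let ?F = "soft_range J (exp a)"
  \<comment> \<open>The coefficients depend on \<open>v\<close> but not on the direction
    \<open>y\<close>. The same \<open>g\<close> and \<open>h\<close> therefore serve for
    \<open>X\<close> and for \<open>Y\<close>, and they are constants under the expectation.\<close>
  obtain g h where h: "\<forall>i j. 0 \<le> h i j" and
    exp: "\<forall>r y. 0 \<le> r \<longrightarrow> \<bar>?F (\<lambda>j. v j + r * y j) - (?F v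
        + r * (\<Sum>i\<in>J. \<Sum>j\<in>J. g i j * (y i - y j)) + r\<^sup>2 / 2 * (\<Sum>i\<in>J. \<Sum>j\<in>J. h i j * (y i - y j)\<^sup>2))\<bar>
      \<le> 8 * r ^ 3 * (\<Sum>j\<in>J. \<bar>y j\<bar>) ^ 3"
    by (rule soft_range_expansion[OF J exp_ge_zero[of a], where v=v]) (rule that; assumption)
  have expectation: "\<bar>(\<integral>\<omega>. ?F (\<lambda>j. v j + r * Z j \<omega>) \<partial>Q) - (?F v + r\<^sup>2 / 2 * (\<Sum>i\<in>J. \<Sum>j\<in>J. h i j * (E i i + E j j - 2 * E i j)))\<bar>
      \<le> 8 * r ^ 3 * (\<integral>\<omega>. (\<Sum>j\<in>J. \<bar>Z j \<omega>\<bar>) ^ 3 \<partial>Q)"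
    if Z: "centered_gaussian_process Q J E Z" for Q :: "'q measure" and E Z
  proof -
    note m = centered_gaussian_process_moments[OF Z]
    note inc = centered_gaussian_process_increment[OF Z]
    interpret prob_space Q by (rule m)
    let ?A = "\<lambda>\<omega>. ?F v + r * (\<Sum>i\<in>J. \<Sum>j\<in>J. g i j * (Z i \<omega> - Z j \<omega>)) + r\<^sup>2 / 2 * (\<Sum>i\<in>J. \<Sum>j\<in>J. h i j * (Z i \<omega> - Z j \<omega>)\<^sup>2)"
    have iF: "integrable Q (\<lambda>\<omega>. ?F (\<lambda>j. v j + r * Z j \<omega>))"
      using m by (intro soft_range_integrable J) auto
    have i1: "integrable Q (\<lambda>\<omega>. r * (\<Sum>i\<in>J. \<Sum>j\<in>J. g i j * (Z i \<omega> - Z j \<omega>)))"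
      using m by auto
    have i2: "integrable Q (\<lambda>\<omega>. r\<^sup>2 / 2 * (\<Sum>i\<in>J. \<Sum>j\<in>J. h i j * (Z i \<omega> - Z j \<omega>)\<^sup>2))"
      using inc by auto
    have iA: "integrable Q ?A"
      using i1 i2 by auto
    have "(\<integral>\<omega>. ?A \<omega> \<partial>Q) = ?F v + (\<integral>\<omega>. r * (\<Sum>i\<in>J. \<Sum>j\<in>J. g i j * (Z i \<omega> - Z j \<omega>)) \<partial>Q)
        + (\<integral>\<omega>. r\<^sup>2 / 2 * (\<Sum>i\<in>J. \<Sum>j\<in>J. h i j * (Z i \<omega> - Z j \<omega>)\<^sup>2) \<partial>Q)"
      using i1 i2 by (simp add: prob_space)
    also have "(\<integral>\<omega>. r * (\<Sum>i\<in>J. \<Sum>j\<in>J. g i j * (Z i \<omega> - Z j \<omega>)) \<partial>Q) = 0"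
      using m by (simp add: Bochner_Integration.integral_sum)
    also have "(\<integral>\<omega>. r\<^sup>2 / 2 * (\<Sum>i\<in>J. \<Sum>j\<in>J. h i j * (Z i \<omega> - Z j \<omega>)\<^sup>2) \<partial>Q)
        = r\<^sup>2 / 2 * (\<Sum>i\<in>J. \<Sum>j\<in>J. h i j * (E i i + E j j - 2 * E i j))"
      using inc by (simp add: Bochner_Integration.integral_sum)
    finally have A: "(\<integral>\<omega>. ?A \<omega> \<partial>Q) = ?F v + r\<^sup>2 / 2 * (\<Sum>i\<in>J. \<Sum>j\<in>J. h i j * (E i i + E j j - 2 * E i j))"
      by simp
    have "\<bar>(\<integral>\<omega>. ?F (\<lambda>j. v j + r * Z j \<omega>) - ?A \<omega> \<partial>Q)\<bar> \<le> (\<integral>\<omega>. 8 * r ^ 3 * (\<Sum>j\<in>J. \<bar>Z j \<omega>\<bar>) ^ 3 \<partial>Q)"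
      using exp[rule_format, OF r] iF iA integrable_sum_abs_cube[OF Z J]
      by (intro order_trans[OF integral_abs_bound] integral_mono) auto
    then show ?thesis
      unfolding Bochner_Integration.integral_diff[OF iF iA] A integral_mult_right_zero .
  qed
  have "r\<^sup>2 / 2 * (\<Sum>i\<in>J. \<Sum>j\<in>J. h i j * (C i i + C j j - 2 * C i j))
      \<le> r\<^sup>2 / 2 * (\<Sum>i\<in>J. \<Sum>j\<in>J. h i j * (D i i + D j j - 2 * D i j))"
    using h le by (intro mult_left_mono sum_mono) (simp_all add: mult_left_mono)
  then show "(\<integral>\<omega>. ?F (\<lambda>j. v j + r * X j \<omega>) \<partial>M) \<le> (\<integral>\<omega>. ?F (\<lambda>j. v j + r * Y j \<omega>) \<partial>N)
     + (8 * (\<integral>\<omega>. (\<Sum>j\<in>J. \<bar>X j \<omega>\<bar>) ^ 3 \<partial>M) + 8 * (\<integral>\<omega>. (\<Sum>j\<in>J. \<bar>Y j \<omega>\<bar>) ^ 3 \<partial>N)) * r ^ 3"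
    using expectation[OF X] expectation[OF Y] by (simp add: abs_le_iff algebra_simps)
qed

text \<open>The two coefficients are free because it is used at two levels: for mixtures of
  \<open>X\<close> and \<open>Y\<close> whose squared coefficients need not add up to 1, and for
  adding a small independent copy to such a mixture.\<close>

definition interpolation :: "('i \<Rightarrow> 'a \<Rightarrow> real) \<Rightarrow> ('i \<Rightarrow> 'b \<Rightarrow> real) \<Rightarrow> real \<Rightarrow> real \<Rightarrow> 'i \<Rightarrow> 'a \<times> 'b \<Rightarrow> real" where
  "interpolation X Y \<alpha> \<beta> j p = \<alpha> * X j (fst p) + \<beta> * Y j (snd p)"

lemma interpolation_measurable:
  assumes [measurable]: "\<And>j. j \<in> J \<Longrightarrow> X j \<in> borel_measurable M" "\<And>j. j \<in> J \<Longrightarrow> Y j \<in> borel_measurable N"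
    and "j \<in> J"
  shows "interpolation X Y \<alpha> \<beta> j \<in> borel_measurable (M \<Otimes>\<^sub>M N)"
  using assms(3) unfolding interpolation_def by measurable

lemma interpolation_integrable:
  assumes "prob_space M" "prob_space N" "integrable M (X j)" "integrable N (Y j)"
  shows "integrable (M \<Otimes>\<^sub>M N) (interpolation X Y \<alpha> \<beta> j)"
  unfolding interpolation_def
  using integrable_comp_fst[OF assms(2,3)] integrable_comp_snd[OF assms(1,2,4)] by auto

lemma soft_range_comparison:
  fixes X :: "'i \<Rightarrow> 'a \<Rightarrow> real" and Y :: "'i \<Rightarrow> 'b \<Rightarrow> real"
  assumes X: "centered_gaussian_process M J C X" and Y: "centered_gaussian_process N J D Y"
    and J: "finite J" "J \<noteq> {}"
    and le: "\<And>i j. i \<in> J \<Longrightarrow> j \<in> J \<Longrightarrow> C i i + C j j - 2 * C i j \<le> D i i + D j j - 2 * D i j"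
  shows "(\<integral>\<omega>. soft_range J (exp a) (\<lambda>j. X j \<omega>) \<partial>M) \<le> (\<integral>\<omega>. soft_range J (exp a) (\<lambda>j. Y j \<omega>) \<partial>N)"
proof -
  note mX = centered_gaussian_process_moments[OF X] and mY = centered_gaussian_process_moments[OF Y]
  interpret M: prob_space M by (rule mX)
  interpret N: prob_space N by (rule mY)
  let ?F = "soft_range J (exp a)"
  let ?P = "M \<Otimes>\<^sub>M N"
  interpret P: pair_prob_space M N ..
  have P: "prob_space ?P" by unfold_locales
  define Z where "Z s = interpolation X Y (sqrt (1 - s)) (sqrt s)" for s
  define u where "u s = (\<integral>p. ?F (\<lambda>j. Z s j p) \<partial>?P)" for s
  note F = soft_range_measurable soft_range_restrict
  have cfP: "(CLINT p|?P. iexp (\<Sum>j\<in>J. b j * interpolation X Y \<alpha> \<beta> j p)) =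
      exp (- of_real (\<alpha>\<^sup>2 * quadratic_form J C b + \<beta>\<^sup>2 * quadratic_form J D b) / 2)" for \<alpha> \<beta> b
  proof -
    have "(CLINT p|?P. iexp (\<Sum>j\<in>J. b j * interpolation X Y \<alpha> \<beta> j p)) =
      exp (- of_real (\<alpha>\<^sup>2 * quadratic_form J C b) / 2) * exp (- of_real (\<beta>\<^sup>2 * quadratic_form J D b) / 2)"
      unfolding interpolation_def
      by (subst independent_sum_cf[OF mX(1,2) mY(1,2)])
         (simp_all only: centered_gaussian_process_cf[OF X J(1)] centered_gaussian_process_cf[OF Y J(1)] quadratic_form_scale)
    then show ?thesis by (simp add: exp_add[symmetric] add_divide_distrib diff_divide_distrib)
  qed
  have Zm: "Z s j \<in> borel_measurable ?P" if "j \<in> J" for s j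
    unfolding Z_def by (rule interpolation_measurable[OF mX(2) mY(2) that])
  have "\<exists>\<kappa>. \<forall>v r. 0 \<le> r \<longrightarrow>
    (\<integral>\<omega>. ?F (\<lambda>j. v j + r * X j \<omega>) \<partial>M) \<le> (\<integral>\<omega>. ?F (\<lambda>j. v j + r * Y j \<omega>) \<partial>N) + \<kappa> * r ^ 3"
    by (rule soft_range_gaussian_step[OF X Y J le])
  then obtain \<kappa> where \<kappa>: "\<forall>v r. 0 \<le> r \<longrightarrow>
    (\<integral>\<omega>. ?F (\<lambda>j. v j + r * X j \<omega>) \<partial>M) \<le> (\<integral>\<omega>. ?F (\<lambda>j. v j + r * Y j \<omega>) \<partial>N) + \<kappa> * r ^ 3"
    by (rule exE)
  have step: "u s \<le> u (s + \<epsilon>) + \<kappa> * sqrt \<epsilon> ^ 3" if s: "0 \<le> s" "0 \<le> \<epsilon>" "s + \<epsilon> \<le> 1" for s \<epsilon>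
  proof -
    \<comment> \<open>The common vector. An independent copy of \<open>X\<close> scaled by
      \<open>sqrt \<epsilon>\<close> raises the share of \<open>C\<close> from
      \<open>1 - s - \<epsilon>\<close> to \<open>1 - s\<close>, giving the law at \<open>s\<close>;
      a copy of \<open>Y\<close> raises the share of \<open>D\<close> from \<open>s\<close> to
      \<open>s + \<epsilon>\<close>, giving the law at \<open>s + \<epsilon>\<close>.\<close>
    define V where "V = interpolation X Y (sqrt (1 - s - \<epsilon>)) (sqrt s)"
    have Vm: "V j \<in> borel_measurable ?P" if "j \<in> J" for j
      unfolding V_def by (rule interpolation_measurable[OF mX(2) mY(2) that])
    have Vi: "integrable ?P (V j)" if "j \<in> J" for j
      unfolding V_def using that by (intro interpolation_integrable mX mY)
    have swap: "(\<integral>p. (\<integral>\<omega>. ?F (\<lambda>j. V j p + sqrt \<epsilon> * W j \<omega>) \<partial>Q) \<partial>?P) = u t \<and>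
        integrable ?P (\<lambda>p. \<integral>\<omega>. ?F (\<lambda>j. V j p + sqrt \<epsilon> * W j \<omega>) \<partial>Q)"
      if W: "centered_gaussian_process Q J E W"
        and t: "\<And>b. (1 - s - \<epsilon>) * quadratic_form J C b + s * quadratic_form J D b + \<epsilon> * quadratic_form J E b
          = (1 - t) * quadratic_form J C b + t * quadratic_form J D b" "0 \<le> t" "t \<le> 1"
      for Q :: "'q measure" and E W t
    proof -
      note mW = centered_gaussian_process_moments[OF W]
      interpret Q: prob_space Q by (rule mW)
      interpret PQ: pair_prob_space ?P Q ..
      have PQ: "prob_space (?P \<Otimes>\<^sub>M Q)" by unfold_locales
      let ?U = "interpolation V W 1 (sqrt \<epsilon>)"
      have int: "integrable (?P \<Otimes>\<^sub>M Q) (\<lambda>p. ?F (\<lambda>j. ?U j p))"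
        by (rule soft_range_integrable[OF PQ J]) (intro interpolation_integrable P Vi mW)
      have cf: "(CLINT p|?P \<Otimes>\<^sub>M Q. iexp (\<Sum>j\<in>J. b j * ?U j p)) = (CLINT p|?P. iexp (\<Sum>j\<in>J. b j * Z t j p))" for b
      proof -
        have "(CLINT p|?P \<Otimes>\<^sub>M Q. iexp (\<Sum>j\<in>J. b j * ?U j p)) =
          exp (- of_real ((1 - s - \<epsilon>) * quadratic_form J C b + s * quadratic_form J D b) / 2) *
          exp (- of_real (\<epsilon> * quadratic_form J E b) / 2)"
          unfolding interpolation_def[of V]
          using s by (subst independent_sum_cf[OF P Vm mW(1,2)])
             (simp_all only: centered_gaussian_process_cf[OF W J(1)] quadratic_form_scale mult_1 V_def cfP
               real_sqrt_pow2 diff_ge_0_iff_ge le_diff_eq add.commute)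
        also have "\<dots> = exp (- of_real ((1 - s - \<epsilon>) * quadratic_form J C b + s * quadratic_form J D b + \<epsilon> * quadratic_form J E b) / 2)"
          unfolding exp_add[symmetric] by (simp add: add_divide_distrib diff_divide_distrib)
        also have "\<dots> = (CLINT p|?P. iexp (\<Sum>j\<in>J. b j * Z t j p))"
          unfolding Z_def cfP t(1) using t by simp
        finally show ?thesis .
      qed
      have "(\<integral>p. (\<integral>\<omega>. ?F (\<lambda>j. ?U j (p, \<omega>)) \<partial>Q) \<partial>?P) = (\<integral>p. ?F (\<lambda>j. ?U j p) \<partial>(?P \<Otimes>\<^sub>M Q))"
        by (rule PQ.integral_fst'[OF int])
      also have "\<dots> = u t"
        unfolding u_def
        by (rule joint_cf_integral_eq[OF PQ _ P Zm J(1) cf F]) (rule interpolation_measurable[OF Vm mW(2)])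
      finally show ?thesis
        using PQ.integrable_fst'[OF int] by (simp add: interpolation_def)
    qed
    have 1: "(\<integral>p. (\<integral>\<omega>. ?F (\<lambda>j. V j p + sqrt \<epsilon> * X j \<omega>) \<partial>M) \<partial>?P) = u s"
      "integrable ?P (\<lambda>p. \<integral>\<omega>. ?F (\<lambda>j. V j p + sqrt \<epsilon> * X j \<omega>) \<partial>M)"
      using swap[OF X, of s] s by (auto simp: algebra_simps)
    have 2: "(\<integral>p. (\<integral>\<omega>. ?F (\<lambda>j. V j p + sqrt \<epsilon> * Y j \<omega>) \<partial>N) \<partial>?P) = u (s + \<epsilon>)"
      "integrable ?P (\<lambda>p. \<integral>\<omega>. ?F (\<lambda>j. V j p + sqrt \<epsilon> * Y j \<omega>) \<partial>N)"
      using swap[OF Y, of "s + \<epsilon>"] s by (auto simp: algebra_simps)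
    \<comment> \<open>The Gaussian step is applied for each fixed value of \<open>V\<close> and then
      integrated, which is legitimate because \<open>\<kappa>\<close> does not depend on that
      value.\<close>
    have "u s \<le> (\<integral>p. (\<integral>\<omega>. ?F (\<lambda>j. V j p + sqrt \<epsilon> * Y j \<omega>) \<partial>N) + \<kappa> * sqrt \<epsilon> ^ 3 \<partial>?P)"
      unfolding 1(1)[symmetric] using 1(2) 2(2) \<kappa>[rule_format] s by (intro integral_mono) auto
    also have "\<dots> = u (s + \<epsilon>) + \<kappa> * sqrt \<epsilon> ^ 3"
      using 2 by (simp add: P.prob_space)
    finally show ?thesis .
  qed
  have telescope: "u 0 \<le> u 1 + \<kappa> / sqrt (real n)" if n: "0 < n" for n :: nat
  proof -
    define \<epsilon> where "\<epsilon> = 1 / real n"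
    have "u 0 \<le> u (real k * \<epsilon>) + real k * (\<kappa> * sqrt \<epsilon> ^ 3)" if "k \<le> n" for k
      using that
    proof (induction k)
      case (Suc k)
      have "real k * \<epsilon> + \<epsilon> = real (Suc k) * \<epsilon>" by (simp add: distrib_right)
      moreover have "real (Suc k) * \<epsilon> \<le> 1" using Suc.prems n unfolding \<epsilon>_def by (simp add: field_simps)
      ultimately show ?case
        using Suc step[of "real k * \<epsilon>" \<epsilon>] n by (simp add: \<epsilon>_def distrib_right)
    qed simp
    from this[of n] have "u 0 \<le> u 1 + real n * (\<kappa> * sqrt \<epsilon> ^ 3)" using n by (simp add: \<epsilon>_def)
    also have "real n * (\<kappa> * sqrt \<epsilon> ^ 3) = \<kappa> / sqrt (real n)"
      using n by (simp add: \<epsilon>_def real_sqrt_divide power3_eq_cube field_simps)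
    finally show ?thesis .
  qed
  have "u 0 \<le> u 1"
  proof (rule LIMSEQ_le_const)
    have "(\<lambda>n. u 1 + \<kappa> / sqrt (real n)) \<longlonglongrightarrow> u 1 + 0"
      by (intro tendsto_add tendsto_const real_tendsto_divide_at_top[OF tendsto_const]
          filterlim_compose[OF sqrt_at_top] filterlim_real_sequentially)
    then show "(\<lambda>n. u 1 + \<kappa> / sqrt (real n)) \<longlonglongrightarrow> u 1" by simp
    show "\<exists>N. \<forall>n\<ge>N. u 0 \<le> u 1 + \<kappa> / sqrt (real n)"
      using telescope by (intro exI[of _ 1]) auto
  qed
  moreover have "(\<integral>\<omega>. ?F (\<lambda>j. X j \<omega>) \<partial>M) = u 0"
    unfolding u_def Z_def
    by (rule joint_cf_integral_eq[OF mX(1,2) P interpolation_measurable[OF mX(2) mY(2)] J(1) _ F])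
       (simp_all add: cfP centered_gaussian_process_cf[OF X J(1)] del: of_real_sum of_real_mult)
  moreover have "(\<integral>\<omega>. ?F (\<lambda>j. Y j \<omega>) \<partial>N) = u 1"
    unfolding u_def Z_def
    by (rule joint_cf_integral_eq[OF mY(1,2) P interpolation_measurable[OF mX(2) mY(2)] J(1) _ F])
       (simp_all add: cfP centered_gaussian_process_cf[OF Y J(1)] del: of_real_sum of_real_mult)
  ultimately show ?thesis by simp
qed

text \<open>Scaling the processes and the threshold by \<open>\<beta>\<close> and dividing the
  result by \<open>\<beta>\<close> reduces the approximation error from \<open>L\<close> to
  \<open>L / \<beta>\<close>, with \<open>L\<close> depending only on the number of indices. The
  comparison of increments survives because both covariances are multiplied by
  \<open>\<beta>\<^sup>2\<close>.\<close>

lemma max_range_comparison: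
  fixes X :: "'i \<Rightarrow> 'a \<Rightarrow> real" and Y :: "'i \<Rightarrow> 'b \<Rightarrow> real"
  assumes X: "centered_gaussian_process M J C X" and Y: "centered_gaussian_process N J D Y"
    and J: "finite J" "J \<noteq> {}"
    and le: "\<And>i j. i \<in> J \<Longrightarrow> j \<in> J \<Longrightarrow> C i i + C j j - 2 * C i j \<le> D i i + D j j - 2 * D i j"
  shows "(\<integral>\<omega>. max (max_range J (\<lambda>j. X j \<omega>)) a \<partial>M) \<le> (\<integral>\<omega>. max (max_range J (\<lambda>j. Y j \<omega>)) a \<partial>N)"
    (is "?I \<le> ?I'")
proof -
  note mX = centered_gaussian_process_moments[OF X] and mY = centered_gaussian_process_moments[OF Y]
  interpret M: prob_space M by (rule mX)
  interpret N: prob_space N by (rule mY)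
  define L where "L = ln ((real (card J))\<^sup>2 + real (card J))"
  have iX: "integrable M (\<lambda>\<omega>. max_range J (\<lambda>j. X j \<omega>))"
    by (rule max_range_integrable[OF mX(1) J mX(4)])
  have iY: "integrable N (\<lambda>\<omega>. max_range J (\<lambda>j. Y j \<omega>))"
    by (rule max_range_integrable[OF mY(1) J mY(4)])
  have bound: "?I \<le> ?I' + L / real n" if n: "0 < n" for n :: nat
  proof -
    define \<beta> where "\<beta> = real n"
    have \<beta>: "0 < \<beta>" using n by (simp add: \<beta>_def)
    let ?F = "soft_range J (exp (\<beta> * a))"
    have scale: "max (max_range J (\<lambda>j. \<beta> * x j)) (\<beta> * a) = \<beta> * max (max_range J x) a" for x
      using \<beta> by (simp add: max_range_scale[OF J] max_mult_distrib_left)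
    note bounds = soft_range_bounds[OF J, where a="\<beta> * a", unfolded L_def[symmetric], where x="\<lambda>j. \<beta> * x j" for x, unfolded scale]
    have iFX: "integrable M (\<lambda>\<omega>. ?F (\<lambda>j. \<beta> * X j \<omega>))"
      using mX by (intro soft_range_integrable J) auto
    have iFY: "integrable N (\<lambda>\<omega>. ?F (\<lambda>j. \<beta> * Y j \<omega>))"
      using mY by (intro soft_range_integrable J) auto
    have "\<beta> * ?I = (\<integral>\<omega>. \<beta> * max (max_range J (\<lambda>j. X j \<omega>)) a \<partial>M)" by simp
    also have "\<dots> \<le> (\<integral>\<omega>. ?F (\<lambda>j. \<beta> * X j \<omega>) \<partial>M)"
      using iX iFX bounds(1) by (intro integral_mono) auto
    also have "\<dots> \<le> (\<integral>\<omega>. ?F (\<lambda>j. \<beta> * Y j \<omega>) \<partial>N)"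
    proof (rule soft_range_comparison[OF centered_gaussian_process_scale[OF X] centered_gaussian_process_scale[OF Y] J])
      fix i j assume "i \<in> J" "j \<in> J"
      then have "\<beta>\<^sup>2 * (C i i + C j j - 2 * C i j) \<le> \<beta>\<^sup>2 * (D i i + D j j - 2 * D i j)"
        using le by (intro mult_left_mono) auto
      then show "\<beta>\<^sup>2 * C i i + \<beta>\<^sup>2 * C j j - 2 * (\<beta>\<^sup>2 * C i j) \<le> \<beta>\<^sup>2 * D i i + \<beta>\<^sup>2 * D j j - 2 * (\<beta>\<^sup>2 * D i j)"
        by (simp add: algebra_simps)
    qed
    also have "\<dots> \<le> (\<integral>\<omega>. \<beta> * max (max_range J (\<lambda>j. Y j \<omega>)) a + L \<partial>N)"
      using iY iFY bounds(2) by (intro integral_mono) auto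
    also have "\<dots> = \<beta> * ?I' + L" using iY by (simp add: N.prob_space)
    finally show ?thesis using \<beta> by (simp add: \<beta>_def[symmetric] field_simps)
  qed
  show ?thesis
  proof (rule LIMSEQ_le_const)
    have "(\<lambda>n. ?I' + L / real n) \<longlonglongrightarrow> ?I' + 0"
      by (intro tendsto_add tendsto_const real_tendsto_divide_at_top[OF tendsto_const] filterlim_real_sequentially)
    then show "(\<lambda>n. ?I' + L / real n) \<longlonglongrightarrow> ?I'" by simp
    show "\<exists>N. \<forall>n\<ge>N. ?I \<le> ?I' + L / real n"
      using bound by (intro exI[of _ 1]) auto
  qed
qed

section \<open>Convex functions and extended expectations\<close>

text \<open>For \<open>k = 0\<close> the truncated subtraction makes the slope 0. In \<open>hinge_sum\<close> the slope on the cell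
  \<open>{k \<delta>..(k + 1) \<delta>}\<close> is that of \<open>g\<close> on the preceding cell, so the approximation stays below \<open>g\<close>.\<close>

definition chord_slope :: "(real \<Rightarrow> real) \<Rightarrow> real \<Rightarrow> nat \<Rightarrow> real" where
  "chord_slope g \<delta> k = (g (real k * \<delta>) - g (real (k - 1) * \<delta>)) / \<delta>"

definition hinge_sum :: "(real \<Rightarrow> real) \<Rightarrow> real \<Rightarrow> nat \<Rightarrow> real \<Rightarrow> real" where
  "hinge_sum g \<delta> N x = (\<Sum>k<N. (chord_slope g \<delta> (Suc k) - chord_slope g \<delta> k) * (max x (real (Suc k) * \<delta>) - real (Suc k) * \<delta>))"

lemma chord_slope_nonneg:
  assumes "mono_on {0..} g" "0 < \<delta>"
  shows "0 \<le> chord_slope g \<delta> k"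
  unfolding chord_slope_def using assms by (auto intro!: divide_nonneg_pos monotone_onD[OF assms(1)] mult_right_mono)

text \<open>This makes the coefficients of the hinges nonnegative. Convexity compares consecutive
  genuine chords; the first comparison, with the artificial slope 0, rests on monotonicity.\<close>

lemma chord_slope_mono:
  assumes g: "mono_on {0..} g" "convex_on {0..} g" and \<delta>: "0 < \<delta>"
  shows "chord_slope g \<delta> k \<le> chord_slope g \<delta> (Suc k)"
proof (cases k)
  case 0
  then show ?thesis using chord_slope_nonneg[OF g(1) \<delta>, of 1] by (simp add: chord_slope_def)
next
  case (Suc m)
  have less: "real m * \<delta> < real (Suc m) * \<delta>" "real (Suc m) * \<delta> < real (Suc (Suc m)) * \<delta>"
    using \<delta> by (auto intro: mult_strict_right_mono)
  have "(g (real m * \<delta>) - g (real (Suc m) * \<delta>)) / (real m * \<delta> - real (Suc m) * \<delta>)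
    \<le> (g (real (Suc m) * \<delta>) - g (real (Suc (Suc m)) * \<delta>)) / (real (Suc m) * \<delta> - real (Suc (Suc m)) * \<delta>)"
    using \<delta> by (intro order_trans[OF convex_on_slope_le(1)[OF g(2) _ _ less] convex_on_slope_le(2)[OF g(2) _ _ less]]) auto
  moreover have "real m * \<delta> - real (Suc m) * \<delta> = - \<delta>" "real (Suc m) * \<delta> - real (Suc (Suc m)) * \<delta> = - \<delta>"
    by (simp_all add: algebra_simps)
  ultimately show ?thesis using \<delta> by (simp add: Suc chord_slope_def field_simps)
qed

lemma hinge_sum_nonneg:
  assumes "mono_on {0..} g" "convex_on {0..} g" "0 < \<delta>"
  shows "0 \<le> hinge_sum g \<delta> N x"
  unfolding hinge_sum_def using chord_slope_mono[OF assms] by (intro sum_nonneg mult_nonneg_nonneg) auto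

lemma hinge_sum_mono:
  assumes "mono_on {0..} g" "convex_on {0..} g" "0 < \<delta>" "N \<le> N'"
  shows "hinge_sum g \<delta> N x \<le> hinge_sum g \<delta> N' x"
  unfolding hinge_sum_def using chord_slope_mono[OF assms(1-3)] assms(4)
  by (intro sum_mono2) auto

text \<open>The induction needs both claims. Past its last knot \<open>N * \<delta>\<close> the
  approximation is a straight line whose slope is the accumulated, telescoping one and whose
  starting value is \<open>g\<close> one cell earlier. Past its own cell a chord of
  \<open>g\<close>, prolonged, lies below \<open>g\<close> by convexity, and the delayed starting
  value lowers the line further by monotonicity.\<close>

lemma hinge_sum_bounds:
  assumes g: "mono_on {0..} g" "convex_on {0..} g" and \<delta>: "0 < \<delta>"
  shows hinge_sum_le: "0 \<le> x \<Longrightarrow> g 0 + hinge_sum g \<delta> N x \<le> g x"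
    and hinge_sum_linear: "real N * \<delta> \<le> x \<Longrightarrow>
      g 0 + hinge_sum g \<delta> N x = g (real (N - 1) * \<delta>) + chord_slope g \<delta> N * (x - real N * \<delta>)"
proof (induction N arbitrary: x)
  case 0
  { case 1
    then show ?case using monotone_onD[OF g(1), of 0 x] by (simp add: hinge_sum_def)
  next
    case 2
    then show ?case by (simp add: hinge_sum_def chord_slope_def) }
next
  case (Suc N)
  have rec: "hinge_sum g \<delta> (Suc N) x = hinge_sum g \<delta> N x +
      (chord_slope g \<delta> (Suc N) - chord_slope g \<delta> N) * (max x (real (Suc N) * \<delta>) - real (Suc N) * \<delta>)" for x
    by (simp add: hinge_sum_def)
  have lin: "g 0 + hinge_sum g \<delta> (Suc N) x = g (real N * \<delta>) + chord_slope g \<delta> (Suc N) * (x - real (Suc N) * \<delta>)"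
    if x: "real (Suc N) * \<delta> \<le> x" for x
  proof -
    have "real N * \<delta> \<le> x" using x \<delta> by (simp add: distrib_right)
    then have "g 0 + hinge_sum g \<delta> N x = g (real (N - 1) * \<delta>) + chord_slope g \<delta> N * (x - real N * \<delta>)"
      by (rule Suc.IH(2))
    moreover have "chord_slope g \<delta> N * \<delta> = g (real N * \<delta>) - g (real (N - 1) * \<delta>)"
      using \<delta> by (simp add: chord_slope_def)
    ultimately show ?thesis using x unfolding rec by (simp add: algebra_simps)
  qed
  { case 1
    show ?case
    proof (cases "x \<le> real (Suc N) * \<delta>")
      case True
      then show ?thesis using Suc.IH(1)[OF 1] by (simp add: rec)
    next
      case False
      have less: "real N * \<delta> < real (Suc N) * \<delta>" "real (Suc N) * \<delta> < x"
        using \<delta> False by (auto intro: mult_strict_right_mono)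
      have "(g (real N * \<delta>) - g (real (Suc N) * \<delta>)) / (real N * \<delta> - real (Suc N) * \<delta>)
          \<le> (g (real (Suc N) * \<delta>) - g x) / (real (Suc N) * \<delta> - x)"
        using \<delta> 1 by (intro order_trans[OF convex_on_slope_le(1)[OF g(2) _ _ less] convex_on_slope_le(2)[OF g(2) _ _ less]]) auto
      moreover have "real N * \<delta> - real (Suc N) * \<delta> = - \<delta>" by (simp add: algebra_simps)
      ultimately have "chord_slope g \<delta> (Suc N) \<le> (g x - g (real (Suc N) * \<delta>)) / (x - real (Suc N) * \<delta>)"
        by (simp add: chord_slope_def minus_divide_left[symmetric] minus_divide_divide[of "g x - _", symmetric] diff_divide_distrib[symmetric])
           (metis minus_diff_eq minus_divide_divide minus_divide_left minus_divide_right)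
      then have "chord_slope g \<delta> (Suc N) * (x - real (Suc N) * \<delta>) \<le> g x - g (real (Suc N) * \<delta>)"
        using less by (simp add: pos_le_divide_eq)
      moreover have "g (real N * \<delta>) \<le> g (real (Suc N) * \<delta>)"
        using less \<delta> by (intro monotone_onD[OF g(1)]) auto
      ultimately show ?thesis using lin[of x] less by simp
    qed
  next
    case 2
    then show ?case using lin[of x] by simp }
qed

text \<open>If \<open>x\<close> lies in the cell starting at \<open>m * \<delta>\<close>, the
  approximation at \<open>x\<close> is at least \<open>g ((m - 1) * \<delta>)\<close>, and this
  point is less than two cells to the left of \<open>x\<close>. The maximum with 0 takes care of the
  first cells.\<close>

lemma hinge_sum_ge:
  assumes g: "mono_on {0..} g" "convex_on {0..} g" and \<delta>: "0 < \<delta>" and x: "0 \<le> x" "x \<le> real N * \<delta>"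
  shows "g (max 0 (x - 2 * \<delta>)) \<le> g 0 + hinge_sum g \<delta> N x"
proof -
  define m where "m = nat \<lfloor>x / \<delta>\<rfloor>"
  have m: "real m * \<delta> \<le> x" "x < real m * \<delta> + \<delta>"
  proof -
    have "real m = of_int \<lfloor>x / \<delta>\<rfloor>" using x \<delta> by (simp add: m_def)
    then have "real m \<le> x / \<delta>" "x / \<delta> < real m + 1" by linarith+
    then show "real m * \<delta> \<le> x" "x < real m * \<delta> + \<delta>"
      using \<delta> by (simp_all add: pos_le_divide_eq pos_divide_less_eq distrib_right)
  qed
  have "real m * \<delta> \<le> real N * \<delta>" using m x by linarith
  then have "m \<le> N" using \<delta> by simp
  have "max 0 (x - 2 * \<delta>) \<le> real (m - 1) * \<delta>"
    using m \<delta> by (cases m) (auto simp: algebra_simps)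
  then have "g (max 0 (x - 2 * \<delta>)) \<le> g (real (m - 1) * \<delta>)"
    using \<delta> by (intro monotone_onD[OF g(1)]) auto
  also have "\<dots> \<le> g 0 + hinge_sum g \<delta> m x"
    unfolding hinge_sum_linear[OF g \<delta> m(1)] using chord_slope_nonneg[OF g(1) \<delta>] m by auto
  also have "\<dots> \<le> g 0 + hinge_sum g \<delta> N x"
    using hinge_sum_mono[OF g \<delta> \<open>m \<le> N\<close>] by simp
  finally show ?thesis .
qed

text \<open>The point 0 is excluded because \<open>g\<close> is unrestricted on negative arguments,
  so that two-sided continuity may fail there.\<close>

lemma isCont_convex_on_nonneg:
  fixes g :: "real \<Rightarrow> real"
  assumes g: "convex_on {0..} g" and x: "0 < x"
  shows "isCont g x"
proof -
  have "convex_on {0<..} g" using g by (rule convex_on_subset) auto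
  then have "continuous_on {0<..} g" by (intro convex_on_continuous) auto
  then show ?thesis using x by (simp add: continuous_on_eq_continuous_at)
qed

text \<open>With mesh \<open>1 / (n + 1)\<close> and \<open>(n + 1)\<^sup>2\<close> knots the cells
  cover the interval up to \<open>n + 1\<close>; refinement and exhaustion of the half-line happen
  together.\<close>

lemma hinge_sum_tendsto:
  assumes g: "mono_on {0..} g" "convex_on {0..} g" and x: "0 \<le> x"
  shows "(\<lambda>n. hinge_sum g (1 / real (Suc n)) ((Suc n)\<^sup>2) x) \<longlonglongrightarrow> g x - g 0"
proof -
  let ?h = "\<lambda>n. hinge_sum g (1 / real (Suc n)) ((Suc n)\<^sup>2) x"
  have d: "(\<lambda>n. 1 / real (Suc n)) \<longlonglongrightarrow> 0"
    using LIMSEQ_inverse_real_of_nat by (simp add: inverse_eq_divide)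
  have "(\<lambda>n. g (max 0 (x - 2 * (1 / real (Suc n))))) \<longlonglongrightarrow> g x"
  proof (cases "x = 0")
    case True
    then show ?thesis by simp
  next
    case False
    have "(\<lambda>n. max 0 (x - 2 * (1 / real (Suc n)))) \<longlonglongrightarrow> max 0 (x - 2 * 0)"
      by (intro tendsto_intros d)
    then have "(\<lambda>n. max 0 (x - 2 * (1 / real (Suc n)))) \<longlonglongrightarrow> x" using x by simp
    then show ?thesis
      by (rule isCont_tendsto_compose[OF isCont_convex_on_nonneg[OF g(2)], rotated]) (use False x in simp)
  qed
  moreover have "eventually (\<lambda>n. g (max 0 (x - 2 * (1 / real (Suc n)))) \<le> g 0 + ?h n) sequentially"
  proof -
    obtain m where m: "x \<le> real m" using real_arch_simple by blast
    have "g (max 0 (x - 2 * (1 / real (Suc n)))) \<le> g 0 + ?h n" if "m \<le> n" for n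
    proof (rule hinge_sum_ge[OF g _ x])
      have "x \<le> real (Suc n)" using m that by linarith
      also have "\<dots> = real ((Suc n)\<^sup>2) * (1 / real (Suc n))" by (simp only: of_nat_mult power2_eq_square times_divide_eq_right mult_1_right
          nonzero_mult_div_cancel_right of_nat_neq_0 not_False_eq_True simp_thms)
      finally show "x \<le> real ((Suc n)\<^sup>2) * (1 / real (Suc n))" .
    qed simp
    then show ?thesis by (auto simp: eventually_sequentially)
  qed
  moreover have "eventually (\<lambda>n. g 0 + ?h n \<le> g x) sequentially"
    using hinge_sum_le[OF g _ x] by (intro always_eventually) auto
  ultimately have "(\<lambda>n. g 0 + ?h n) \<longlonglongrightarrow> g x"
    by (rule tendsto_sandwich[OF _ _ _ tendsto_const, rotated 2])
  from tendsto_diff[OF this tendsto_const[of "g 0"]] show ?thesis by simp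
qed

lemma mono_on_nonneg_measurable:
  fixes g :: "real \<Rightarrow> real"
  assumes g: "mono_on {0..} g" and [measurable]: "U \<in> borel_measurable M" and U: "\<And>\<omega>. 0 \<le> U \<omega>"
  shows "(\<lambda>\<omega>. g (U \<omega>)) \<in> borel_measurable M"
proof -
  have "mono (\<lambda>x. g (max 0 x))" using g by (auto simp: mono_def intro!: monotone_onD[OF g])
  then have [measurable]: "(\<lambda>x. g (max 0 x)) \<in> borel_measurable borel" by (rule borel_measurable_mono)
  have "(\<lambda>\<omega>. g (max 0 (U \<omega>))) \<in> borel_measurable M" by measurable
  then show ?thesis using U by (simp add: max_absorb2)
qed

text \<open>Hinge sums inherit the comparison from \<open>le\<close> by linearity. Fatou's lemma
  handles the limit for \<open>U\<close>, while for \<open>V\<close> the bound of the hinge sums by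
  \<open>g - g 0\<close> suffices. The meshes need not be nested, so monotone convergence is not at
  hand. Subtracting \<open>g 0\<close> keeps everything nonnegative, and the right-hand side may be
  infinite.\<close>

lemma increasing_convex_order:
  fixes U :: "'a \<Rightarrow> real" and V :: "'b \<Rightarrow> real"
  assumes M: "prob_space M" "integrable M U" "\<And>\<omega>. 0 \<le> U \<omega>"
    and N: "prob_space N" "integrable N V" "\<And>\<omega>. 0 \<le> V \<omega>"
    and le: "\<And>a. (\<integral>\<omega>. max (U \<omega>) a \<partial>M) \<le> (\<integral>\<omega>. max (V \<omega>) a \<partial>N)"
    and g: "mono_on {0..} g" "convex_on {0..} g"
  shows "(\<integral>\<^sup>+\<omega>. ennreal (g (U \<omega>) - g 0) \<partial>M) \<le> (\<integral>\<^sup>+\<omega>. ennreal (g (V \<omega>) - g 0) \<partial>N)"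
proof -
  interpret M: prob_space M by fact
  interpret N: prob_space N by fact
  define h where "h n = hinge_sum g (1 / real (Suc n)) ((Suc n)\<^sup>2)" for n
  have h0: "0 \<le> h n x" for n x unfolding h_def by (rule hinge_sum_nonneg[OF g]) simp
  have iU: "integrable M (\<lambda>\<omega>. max (U \<omega>) a)" and iV: "integrable N (\<lambda>\<omega>. max (V \<omega>) a)" for a
    using M(2) N(2) by auto
  have ih: "integrable M (\<lambda>\<omega>. h n (U \<omega>))" "integrable N (\<lambda>\<omega>. h n (V \<omega>))" for n
    unfolding h_def hinge_sum_def using iU iV by auto
  have "(\<integral>\<omega>. h n (U \<omega>) \<partial>M) \<le> (\<integral>\<omega>. h n (V \<omega>) \<partial>N)" for n
    unfolding h_def hinge_sum_def using iU iV le chord_slope_mono[OF g]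
    by (simp add: Bochner_Integration.integral_sum M.prob_space N.prob_space sum_mono mult_left_mono)
  then have hle: "(\<integral>\<^sup>+\<omega>. ennreal (h n (U \<omega>)) \<partial>M) \<le> (\<integral>\<^sup>+\<omega>. ennreal (h n (V \<omega>)) \<partial>N)" for n
    using ih h0 by (simp add: nn_integral_eq_integral ennreal_leI)
  have lim: "(\<lambda>n. ennreal (h n (U \<omega>))) \<longlonglongrightarrow> ennreal (g (U \<omega>) - g 0)" for \<omega>
    unfolding h_def by (intro tendsto_ennrealI hinge_sum_tendsto[OF g M(3)])
  have "(\<integral>\<^sup>+\<omega>. ennreal (g (U \<omega>) - g 0) \<partial>M) = (\<integral>\<^sup>+\<omega>. liminf (\<lambda>n. ennreal (h n (U \<omega>))) \<partial>M)"
    using lim by (intro nn_integral_cong lim_imp_Liminf[symmetric]) auto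
  also have "\<dots> \<le> liminf (\<lambda>n. \<integral>\<^sup>+\<omega>. ennreal (h n (U \<omega>)) \<partial>M)"
    using ih by (intro nn_integral_liminf) auto
  also have "\<dots> \<le> liminf (\<lambda>n. \<integral>\<^sup>+\<omega>. ennreal (g (V \<omega>) - g 0) \<partial>N)"
  proof (intro Liminf_mono always_eventually allI)
    fix n
    have "h n (V \<omega>) \<le> g (V \<omega>) - g 0" for \<omega>
      unfolding h_def using hinge_sum_le[OF g _ N(3), of "1 / real (Suc n)" "(Suc n)\<^sup>2" \<omega>] by simp
    then have "(\<integral>\<^sup>+\<omega>. ennreal (h n (V \<omega>)) \<partial>N) \<le> (\<integral>\<^sup>+\<omega>. ennreal (g (V \<omega>) - g 0) \<partial>N)"
      by (intro nn_integral_mono ennreal_leI)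
    then show "(\<integral>\<^sup>+\<omega>. ennreal (h n (U \<omega>)) \<partial>M) \<le> (\<integral>\<^sup>+\<omega>. ennreal (g (V \<omega>) - g 0) \<partial>N)"
      using hle[of n] by (rule order_trans[rotated])
  qed
  also have "\<dots> = (\<integral>\<^sup>+\<omega>. ennreal (g (V \<omega>) - g 0) \<partial>N)" by (simp add: Liminf_const)
  finally show ?thesis .
qed

text \<open>For \<open>c \<le> x\<close> the positive part of \<open>x - c\<close>, the negative
  part of \<open>x\<close> and the positive part of \<open>c\<close> add up to the positive part of
  \<open>x\<close> plus the negative part of \<open>c\<close>. All terms are nonnegative, so the
  identity can be integrated even if both sides are infinite. The lower bound makes the negative
  part \<open>q\<close> finite, so it can be subtracted afterwards.\<close>

lemma extended_expectation_shift:
  assumes M: "prob_space M" and [measurable]: "f \<in> borel_measurable M" and c: "AE \<omega> in M. c \<le> f \<omega>"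
  shows "extended_expectation M f = ereal c + enn2ereal (\<integral>\<^sup>+\<omega>. ennreal (f \<omega> - c) \<partial>M)"
proof -
  interpret prob_space M by fact
  define A p q where "A = (\<integral>\<^sup>+\<omega>. ennreal (f \<omega> - c) \<partial>M)" and "p = (\<integral>\<^sup>+\<omega>. ennreal (f \<omega>) \<partial>M)"
    and "q = (\<integral>\<^sup>+\<omega>. ennreal (- f \<omega>) \<partial>M)"
  have pt: "ennreal (x - c) + ennreal (- x) + ennreal c = ennreal x + ennreal (- c)" if "c \<le> x" for x
    using that by (cases "0 \<le> x"; cases "0 \<le> c") (auto simp: ennreal_plus[symmetric] ennreal_neg simp del: ennreal_plus)
  have "A + q + ennreal c = (\<integral>\<^sup>+\<omega>. ennreal (f \<omega> - c) + ennreal (- f \<omega>) + ennreal c \<partial>M)"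
    unfolding A_def q_def by (simp add: nn_integral_add emeasure_space_1)
  also have "\<dots> = (\<integral>\<^sup>+\<omega>. ennreal (f \<omega>) + ennreal (- c) \<partial>M)"
    using c pt by (intro nn_integral_cong_AE) auto
  also have "\<dots> = p + ennreal (- c)"
    unfolding p_def by (simp add: nn_integral_add emeasure_space_1)
  finally have eq: "A + q + ennreal c = p + ennreal (- c)" .
  have "q \<le> (\<integral>\<^sup>+\<omega>. ennreal \<bar>c\<bar> \<partial>M)"
    unfolding q_def using c by (intro nn_integral_mono_AE) (auto intro!: ennreal_leI)
  then have "q \<le> ennreal \<bar>c\<bar>" by (simp add: emeasure_space_1)
  then obtain q' where q': "q = ennreal q'" "0 \<le> q'"
    by (cases q) (auto simp: top_unique)
  show ?thesis
    unfolding extended_expectation_def A_def[symmetric] p_def[symmetric] q_def[symmetric]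
  proof (cases A)
    case (real a)
    have "p \<noteq> top" using eq real q' by (metis ennreal_add_eq_top ennreal_neq_top)
    then obtain p' where p': "p = ennreal p'" "0 \<le> p'" by (cases p) auto
    have "a + q' + max 0 c = p' + max 0 (- c)"
      using eq real q' p' by (cases "0 \<le> c") (auto simp: ennreal_neg ennreal_plus[symmetric] simp del: ennreal_plus)
    then show "enn2ereal p - enn2ereal q = ereal c + enn2ereal A"
      using real q' p' by (simp add: enn2ereal_ennreal max_def split: if_splits)
  next
    case top
    then have "p = \<infinity>" using eq by (metis ennreal_add_eq_top ennreal_neq_top infinity_ennreal_def)
    then show "enn2ereal p - enn2ereal q = ereal c + enn2ereal A"
      using top q' by (simp add: enn2ereal_ennreal)
  qed
qed

text \<open>The function \<open>f\<close>, in applications a supremum over uncountably many times,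
  is not assumed measurable. It is replaced by the pointwise limit of the \<open>F n\<close>, which
  is measurable and almost everywhere equal to it.\<close>

lemma extended_expectation_limit:
  assumes M: "prob_space M" and [measurable]: "\<And>n. F n \<in> borel_measurable M"
    and inc: "\<And>\<omega>. incseq (\<lambda>n. F n \<omega>)" and c: "\<And>n \<omega>. c \<le> F n \<omega>"
    and lim: "AE \<omega> in M. (\<lambda>n. F n \<omega>) \<longlonglongrightarrow> f \<omega>"
  shows "extended_expectation M f = ereal c + enn2ereal (SUP n. \<integral>\<^sup>+\<omega>. ennreal (F n \<omega> - c) \<partial>M)"
proof -
  interpret prob_space M by fact
  define f' where "f' \<omega> = lim (\<lambda>n. F n \<omega>)" for \<omega>
  have [measurable]: "f' \<in> borel_measurable M" unfolding f'_def by measurable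
  have eq: "AE \<omega> in M. f \<omega> = f' \<omega>" using lim by eventually_elim (simp add: f'_def limI)
  have lim': "AE \<omega> in M. (\<lambda>n. F n \<omega>) \<longlonglongrightarrow> f' \<omega>" using lim eq by eventually_elim simp
  have "extended_expectation M f = extended_expectation M f'"
    unfolding extended_expectation_def using eq
    by (intro arg_cong2[where f="(-)"] arg_cong[where f=enn2ereal] nn_integral_cong_AE) auto
  also have "\<dots> = ereal c + enn2ereal (\<integral>\<^sup>+\<omega>. ennreal (f' \<omega> - c) \<partial>M)"
    using lim' by (intro extended_expectation_shift M) (auto elim!: eventually_mono intro: LIMSEQ_le_const c)
  also have "(\<integral>\<^sup>+\<omega>. ennreal (f' \<omega> - c) \<partial>M) = (\<integral>\<^sup>+\<omega>. (SUP n. ennreal (F n \<omega> - c)) \<partial>M)"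
  proof (rule nn_integral_cong_AE)
    show "AE \<omega> in M. ennreal (f' \<omega> - c) = (SUP n. ennreal (F n \<omega> - c))"
      using lim'
    proof eventually_elim
      case (elim \<omega>)
      have "incseq (\<lambda>n. ennreal (F n \<omega> - c))"
        using inc[of \<omega>] by (auto simp: incseq_def intro!: ennreal_leI)
      then have "(\<lambda>n. ennreal (F n \<omega> - c)) \<longlonglongrightarrow> (SUP n. ennreal (F n \<omega> - c))" by (rule LIMSEQ_SUP)
      moreover have "(\<lambda>n. ennreal (F n \<omega> - c)) \<longlonglongrightarrow> ennreal (f' \<omega> - c)"
        using elim by (intro tendsto_ennrealI tendsto_diff tendsto_const)
      ultimately show ?case by (rule LIMSEQ_unique[symmetric])
    qed
  qed
  also have "\<dots> = (SUP n. \<integral>\<^sup>+\<omega>. ennreal (F n \<omega> - c) \<partial>M)"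
    using inc by (intro nn_integral_monotone_convergence_SUP)
      (auto simp: incseq_def le_fun_def intro!: ennreal_leI)
  finally show ?thesis .
qed

section \<open>Passage to suprema over an interval\<close>

text \<open>The range is the maximum of \<open>x\<close> plus the maximum of \<open>- x\<close>, and
  \<open>- X\<close> has the same covariance as \<open>X\<close>, hence the same law.\<close>

lemma Max_integral_eq_half_range:
  fixes X :: "'i \<Rightarrow> 'a \<Rightarrow> real"
  assumes X: "centered_gaussian_process M J C X" and J: "finite J" "J \<noteq> {}"
  shows "integrable M (\<lambda>\<omega>. Max ((\<lambda>j. X j \<omega>) ` J))"
    and "2 * (\<integral>\<omega>. Max ((\<lambda>j. X j \<omega>) ` J) \<partial>M) = (\<integral>\<omega>. max_range J (\<lambda>j. X j \<omega>) \<partial>M)"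
proof -
  note mX = centered_gaussian_process_moments[OF X]
  define F :: "('i \<Rightarrow> real) \<Rightarrow> real" where "F x = Max (x ` J)" for x
  have X': "centered_gaussian_process M J C (\<lambda>j \<omega>. - X j \<omega>)"
    using centered_gaussian_process_scale[OF X, of "-1"] by simp
  have F: "F \<in> borel_measurable (\<Pi>\<^sub>M j\<in>J. borel)" "F (restrict x J) = F x" for x
    unfolding F_def using J
    by (auto intro!: borel_measurable_Max measurable_component_singleton)
  have int: "integrable M (\<lambda>\<omega>. F (\<lambda>j. Z j \<omega>))" if Z: "\<And>j. j \<in> J \<Longrightarrow> integrable M (Z j)" for Z
  proof (rule Bochner_Integration.integrable_bound)
    show "integrable M (\<lambda>\<omega>. \<Sum>j\<in>J. \<bar>Z j \<omega>\<bar>)" using Z by auto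
    show "(\<lambda>\<omega>. F (\<lambda>j. Z j \<omega>)) \<in> borel_measurable M"
      unfolding F_def using J Z by (intro borel_measurable_Max) auto
    show "AE \<omega> in M. norm (F (\<lambda>j. Z j \<omega>)) \<le> norm (\<Sum>j\<in>J. \<bar>Z j \<omega>\<bar>)"
    proof (rule AE_I2)
      fix \<omega>
      have "F (\<lambda>j. Z j \<omega>) \<in> (\<lambda>j. Z j \<omega>) ` J" unfolding F_def using J by (intro Max_in) auto
      then obtain k where k: "k \<in> J" "F (\<lambda>j. Z j \<omega>) = Z k \<omega>" by auto
      then show "norm (F (\<lambda>j. Z j \<omega>)) \<le> norm (\<Sum>j\<in>J. \<bar>Z j \<omega>\<bar>)"
        using J member_le_sum[of k J "\<lambda>j. \<bar>Z j \<omega>\<bar>"] by (simp add: sum_nonneg)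
    qed
  qed
  have iF: "integrable M (\<lambda>\<omega>. F (\<lambda>j. X j \<omega>))" "integrable M (\<lambda>\<omega>. F (\<lambda>j. - X j \<omega>))"
    using mX by (auto intro!: int)
  then show "integrable M (\<lambda>\<omega>. Max ((\<lambda>j. X j \<omega>) ` J))" by (simp add: F_def)
  have range: "max_range J x = F x + F (\<lambda>j. - x j)" for x
  proof (rule antisym)
    obtain i j where ij: "i \<in> J" "j \<in> J" "max_range J x = x i - x j"
      using max_range_attained[OF J] .
    have "x i \<le> F x" "- x j \<le> F (\<lambda>j. - x j)" unfolding F_def using J ij by auto
    then show "max_range J x \<le> F x + F (\<lambda>j. - x j)" using ij by simp
    have "F x \<in> x ` J" "F (\<lambda>j. - x j) \<in> (\<lambda>j. - x j) ` J"
      unfolding F_def using J by (intro Max_in; auto)+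
    then show "F x + F (\<lambda>j. - x j) \<le> max_range J x" using max_range_ge[OF J(1)] by auto
  qed
  have "(\<integral>\<omega>. F (\<lambda>j. - X j \<omega>) \<partial>M) = (\<integral>\<omega>. F (\<lambda>j. X j \<omega>) \<partial>M)"
    using mX(2) by (intro joint_cf_integral_eq[OF mX(1) _ mX(1) _ J(1) _ F])
      (auto simp only: centered_gaussian_process_cf[OF X J(1)] centered_gaussian_process_cf[OF X' J(1)] intro!: borel_measurable_uminus)
  then show "2 * (\<integral>\<omega>. Max ((\<lambda>j. X j \<omega>) ` J) \<partial>M) = (\<integral>\<omega>. max_range J (\<lambda>j. X j \<omega>) \<partial>M)"
    using iF by (simp add: range) (simp add: F_def)
qed

text \<open>Keeping \<open>x0\<close> in every set makes all of them nonempty and, for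
  \<open>x0 = 0\<close>, lets each finite maximum include the time at which the processes
  vanish.\<close>

lemma finite_exhaustion_dense:
  fixes S :: "real set"
  assumes "x0 \<in> S"
  obtains J :: "nat \<Rightarrow> real set" where "\<And>n. finite (J n)" "\<And>n. x0 \<in> J n" "\<And>n. J n \<subseteq> S" "incseq J"
    "S \<subseteq> closure (\<Union>n. J n)"
proof -
  obtain D where D: "countable D" "D \<subseteq> S" "S \<subseteq> closure D" using separable by metis
  have "D \<noteq> {}" using D(3) assms by auto
  define J where "J n = insert x0 (from_nat_into D ` {..n})" for n
  have "D \<subseteq> (\<Union>n. J n)"
  proof
    fix d assume "d \<in> D"
    then obtain n where "d = from_nat_into D n" using from_nat_into_surj[OF D(1)] by metis
    then show "d \<in> (\<Union>n. J n)" by (auto simp: J_def)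
  qed
  then have "S \<subseteq> closure (\<Union>n. J n)" using D(3) closure_mono by blast
  moreover have "J n \<subseteq> S" for n
    using assms D(2) from_nat_into[OF \<open>D \<noteq> {}\<close>] by (auto simp: J_def)
  moreover have "incseq J" by (auto simp: incseq_def J_def)
  ultimately show thesis by (intro that[of J]) (auto simp: J_def)
qed

lemma max_range_mono:
  assumes "finite J'" "J \<subseteq> J'" "J \<noteq> {}"
  shows "max_range J x \<le> max_range J' x"
  unfolding max_range_def using assms by (intro Max_mono image_mono) auto

lemma dense_approximation:
  fixes f :: "real \<Rightarrow> real"
  assumes f: "continuous_on S f" and J: "\<And>n. J n \<subseteq> S" "incseq J" "S \<subseteq> closure (\<Union>n. J n)"
    and x: "x \<in> S" and e: "0 < e"
  obtains N where "\<And>n. N \<le> n \<Longrightarrow> \<exists>y\<in>J n. \<bar>f y - f x\<bar> < e"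
proof -
  obtain d where d: "0 < d" "\<And>y. y \<in> S \<Longrightarrow> dist y x < d \<Longrightarrow> dist (f y) (f x) < e"
    using f x e unfolding continuous_on_iff by metis
  obtain y where y: "y \<in> (\<Union>n. J n)" "dist y x < d"
    using x J(3) d(1) closure_approachable by (metis subsetD)
  then obtain N where N: "y \<in> J N" by auto
  have "\<exists>y\<in>J n. \<bar>f y - f x\<bar> < e" if "N \<le> n" for n
    using N J(1) d(2)[of y] y(2) incseqD[OF J(2) that] by (auto simp: dist_real_def)
  then show thesis by (rule that)
qed

text \<open>Compactness makes the supremum a value attained at a pair \<open>(a, b)\<close>. Once
  the finite sets contain points where \<open>f\<close> is close to \<open>f a\<close> and to
  \<open>f b\<close>, their range is within \<open>r\<close> of it.\<close>

lemma max_range_tendsto_SUP: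
  fixes f :: "real \<Rightarrow> real"
  assumes f: "continuous_on S f" and S: "compact S" "S \<noteq> {}"
    and J: "\<And>n. finite (J n)" "\<And>n. J n \<noteq> {}" "\<And>n. J n \<subseteq> S" "incseq J" "S \<subseteq> closure (\<Union>n. J n)"
  shows "(\<lambda>n. max_range (J n) f) \<longlonglongrightarrow> (SUP (t, s)\<in>S \<times> S. f t - f s)"
proof -
  obtain a where a: "a \<in> S" "\<And>y. y \<in> S \<Longrightarrow> f y \<le> f a"
    using continuous_attains_sup[OF S f] by auto
  obtain b where b: "b \<in> S" "\<And>y. y \<in> S \<Longrightarrow> f b \<le> f y"
    using continuous_attains_inf[OF S f] by auto
  have sup: "(SUP (t, s)\<in>S \<times> S. f t - f s) = f a - f b"
    using a b by (intro cSup_eq_maximum) (auto intro!: image_eqI[where x="(a, b)"] diff_mono)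
  show ?thesis unfolding sup
  proof (rule LIMSEQ_I)
    fix r :: real assume r: "0 < r"
    obtain N1 where N1: "\<And>n. N1 \<le> n \<Longrightarrow> \<exists>y\<in>J n. \<bar>f y - f a\<bar> < r / 2"
      using dense_approximation[OF f J(3-5) a(1), of "r / 2"] r by auto
    obtain N2 where N2: "\<And>n. N2 \<le> n \<Longrightarrow> \<exists>y\<in>J n. \<bar>f y - f b\<bar> < r / 2"
      using dense_approximation[OF f J(3-5) b(1), of "r / 2"] r by auto
    show "\<exists>no. \<forall>n\<ge>no. norm (max_range (J n) f - (f a - f b)) < r"
    proof (intro exI allI impI)
      fix n assume n: "max N1 N2 \<le> n"
      obtain y where y: "y \<in> J n" "\<bar>f y - f a\<bar> < r / 2" using N1[of n] n by auto
      obtain z where z: "z \<in> J n" "\<bar>f z - f b\<bar> < r / 2" using N2[of n] n by auto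
      have "f y - f z \<le> max_range (J n) f" by (rule max_range_ge[OF J(1) y(1) z(1)])
      moreover obtain i j where ij: "i \<in> J n" "j \<in> J n" "max_range (J n) f = f i - f j"
        using max_range_attained[OF J(1,2)] .
      have "f i \<le> f a" "f b \<le> f j" using ij J(3) a b by auto
      ultimately show "norm (max_range (J n) f - (f a - f b)) < r"
        using y z ij(3) unfolding real_norm_def by linarith
    qed
  qed
qed

lemma Max_tendsto_SUP:
  fixes f :: "real \<Rightarrow> real"
  assumes f: "continuous_on S f" and S: "compact S" "S \<noteq> {}"
    and J: "\<And>n. finite (J n)" "\<And>n. J n \<noteq> {}" "\<And>n. J n \<subseteq> S" "incseq J" "S \<subseteq> closure (\<Union>n. J n)"
  shows "(\<lambda>n. Max (f ` J n)) \<longlonglongrightarrow> (SUP t\<in>S. f t)"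
proof -
  obtain a where a: "a \<in> S" "\<And>y. y \<in> S \<Longrightarrow> f y \<le> f a"
    using continuous_attains_sup[OF S f] by auto
  have sup: "(SUP t\<in>S. f t) = f a"
    using a by (intro cSup_eq_maximum) auto
  show ?thesis unfolding sup
  proof (rule LIMSEQ_I)
    fix r :: real assume r: "0 < r"
    obtain N where N: "\<And>n. N \<le> n \<Longrightarrow> \<exists>y\<in>J n. \<bar>f y - f a\<bar> < r"
      using dense_approximation[OF f J(3-5) a(1) r] by auto
    show "\<exists>no. \<forall>n\<ge>no. norm (Max (f ` J n) - f a) < r"
    proof (intro exI allI impI)
      fix n assume n: "N \<le> n"
      obtain y where y: "y \<in> J n" "\<bar>f y - f a\<bar> < r" using N[OF n] by auto
      have "f y \<le> Max (f ` J n)" using J(1) y(1) by (intro Max_ge) auto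
      moreover have "f x \<le> f a" if "x \<in> J n" for x using that J(3) a(2) by blast
      then have "Max (f ` J n) \<le> f a" using J(1,2) by (subst Max_le_iff) auto
      ultimately show "norm (Max (f ` J n) - f a) < r" using y by simp
    qed
  qed
qed

section \<open>Bifractional Brownian motion\<close>

text \<open>Concavity is used through the inverse function: midpoint convexity of
  \<open>x powr (1 / K)\<close> at the points \<open>a powr K\<close> and \<open>b powr K\<close>.
  The constant is attained for \<open>a = b\<close>. Zero arguments are treated apart because the
  convexity is taken on the open half-line.\<close>

lemma powr_sum_le:
  fixes a b K :: real
  assumes ab: "0 \<le> a" "0 \<le> b" and K: "0 < K" "K \<le> 1"
  shows "a powr K + b powr K \<le> 2 powr (1 - K) * (a + b) powr K"
proof (cases "a = 0 \<or> b = 0")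
  case True
  have "(1::real) \<le> 2 powr (1 - K)" using K by (simp add: ge_one_powr_ge_zero)
  then have "c powr K \<le> 2 powr (1 - K) * c powr K" for c
    using mult_right_mono[of 1 "2 powr (1 - K)" "c powr K"] by simp
  then show ?thesis using True K by auto
next
  case False
  define u v where "u = a powr K" and "v = b powr K"
  have uv: "0 < u" "0 < v" using False ab by (auto simp: u_def v_def)
  have inv: "u powr (1 / K) = a" "v powr (1 / K) = b"
    using ab K by (auto simp: u_def v_def powr_powr)
  have "convex_on {0<..} (\<lambda>x::real. x powr (1 / K))" using K by (intro powr_convex) simp
  then have "((1 - 1/2) *\<^sub>R u + (1/2) *\<^sub>R v) powr (1 / K) \<le> (1 - 1/2) * u powr (1 / K) + (1/2) * v powr (1 / K)"
    using uv by (intro convex_onD) auto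
  then have "((u + v) / 2) powr (1 / K) \<le> (a + b) / 2"
    unfolding inv by (simp add: add_divide_distrib)
  then have "(((u + v) / 2) powr (1 / K)) powr K \<le> ((a + b) / 2) powr K"
    using K by (intro powr_mono2) auto
  then have "(u + v) / 2 \<le> (a + b) powr K / 2 powr K"
    using uv ab K by (simp add: powr_powr powr_divide)
  then show ?thesis by (simp add: u_def v_def powr_diff field_simps)
qed

text \<open>Polarisation doubles the prefactor \<open>1 / 2 powr K\<close>, which gives
  \<open>2 powr (1 - K)\<close> in front of the power of \<open>\<bar>s - t\<bar>\<close>. The
  right-hand side reduces to exactly this term; what remains on the left is nonpositive by
  \<open>powr_sum_le\<close>.\<close>

lemma bifractional_increment_le:
  fixes H K s t :: real
  assumes K: "0 < K" "K \<le> 1"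
  shows "bifractional_cov H K s s + bifractional_cov H K t t - 2 * bifractional_cov H K s t
    \<le> 2 powr (1 - K) * fractional_cov (H * K) s s + 2 powr (1 - K) * fractional_cov (H * K) t t
      - 2 * (2 powr (1 - K) * fractional_cov (H * K) s t)"
proof -
  have b: "bifractional_cov H K r r = (r powr (2 * H)) powr K" for r
    using K by (simp add: bifractional_cov_def powr_mult mult_2[symmetric])
  have two: "2 * (1 / 2 powr K) = (2::real) powr (1 - K)" by (simp add: powr_diff)
  have "bifractional_cov H K s s + bifractional_cov H K t t - 2 * bifractional_cov H K s t
    = (s powr (2 * H)) powr K + (t powr (2 * H)) powr K
      - 2 powr (1 - K) * ((t powr (2 * H) + s powr (2 * H)) powr K) + 2 powr (1 - K) * \<bar>s - t\<bar> powr (2 * H * K)"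
    unfolding b unfolding bifractional_cov_def mult.assoc[symmetric] two by (simp add: right_diff_distrib)
  also have "\<dots> \<le> 2 powr (1 - K) * \<bar>s - t\<bar> powr (2 * H * K)"
    using powr_sum_le[of "s powr (2 * H)" "t powr (2 * H)" K] K by (simp add: add.commute)
  also have "\<dots> = 2 powr (1 - K) * fractional_cov (H * K) s s + 2 powr (1 - K) * fractional_cov (H * K) t t
      - 2 * (2 powr (1 - K) * fractional_cov (H * K) s t)"
    by (simp add: fractional_cov_def field_simps abs_minus_commute)
  finally show ?thesis .
qed

lemma range_functional_limit:
  fixes X :: "real \<Rightarrow> 'a \<Rightarrow> real" and g :: "real \<Rightarrow> real"
  assumes X: "centered_gaussian_process M S C X" "continuous_paths M S X" and S: "compact S" "S \<noteq> {}"
    and J: "\<And>n. finite (J n)" "\<And>n. J n \<noteq> {}" "\<And>n. J n \<subseteq> S" "incseq J" "S \<subseteq> closure (\<Union>n. J n)"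
    and g: "mono_on {0..} g" "convex_on {0..} g"
  shows "extended_expectation M (\<lambda>\<omega>. g (SUP (t, s)\<in>S \<times> S. X t \<omega> - X s \<omega>)) =
    ereal (g 0) + enn2ereal (SUP n. \<integral>\<^sup>+\<omega>. ennreal (g (max_range (J n) (\<lambda>t. X t \<omega>)) - g 0) \<partial>M)"
proof (rule extended_expectation_limit)
  note mX = centered_gaussian_process_moments[OF X(1)]
  show "prob_space M" by (rule mX)
  have nonneg: "0 \<le> max_range (J n) x" for n x by (rule max_range_nonneg[OF J(1,2)])
  show "(\<lambda>\<omega>. g (max_range (J n) (\<lambda>t. X t \<omega>))) \<in> borel_measurable M" for n
    using mX(2) J(1,3) by (intro mono_on_nonneg_measurable[OF g(1)] nonneg max_range_measurable) auto
  have inc: "max_range (J m) x \<le> max_range (J n) x" if "m \<le> n" for m n x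
    by (rule max_range_mono[OF J(1) incseqD[OF J(4) that] J(2)])
  show "incseq (\<lambda>n. g (max_range (J n) (\<lambda>t. X t \<omega>)))" for \<omega>
    using inc nonneg by (auto simp: incseq_def intro!: monotone_onD[OF g(1)])
  show "g 0 \<le> g (max_range (J n) (\<lambda>t. X t \<omega>))" for n \<omega>
    using nonneg by (intro monotone_onD[OF g(1)]) auto
  have "AE \<omega> in M. continuous_on S (\<lambda>t. X t \<omega>)" using X(2) by (simp add: continuous_paths_def)
  then show "AE \<omega> in M. (\<lambda>n. g (max_range (J n) (\<lambda>t. X t \<omega>))) \<longlonglongrightarrow> g (SUP (t, s)\<in>S \<times> S. X t \<omega> - X s \<omega>)"
  proof eventually_elim
    case (elim \<omega>)
    define R where "R = (SUP (t, s)\<in>S \<times> S. X t \<omega> - X s \<omega>)"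
    have lim: "(\<lambda>n. max_range (J n) (\<lambda>t. X t \<omega>)) \<longlonglongrightarrow> R"
      unfolding R_def by (rule max_range_tendsto_SUP[OF elim S J])
    have le: "max_range (J n) (\<lambda>t. X t \<omega>) \<le> R" for n
      using lim inc by (intro incseq_le) (auto simp: incseq_def)
    have "(\<lambda>n. g (max_range (J n) (\<lambda>t. X t \<omega>))) \<longlonglongrightarrow> g R"
    \<comment> \<open>A path with zero range is treated by hand, since continuity of
      \<open>g\<close> is available only at positive points: the finite ranges lie between 0 and
      \<open>R\<close>, so the sequence is constant.\<close>
    proof (cases "R \<le> 0")
      case True
      then have "max_range (J n) (\<lambda>t. X t \<omega>) = R" for n
        using le[of n] nonneg[of n "\<lambda>t. X t \<omega>"] by linarith
      then show ?thesis by simp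
    next
      case False
      then show ?thesis
        by (intro isCont_tendsto_compose[OF isCont_convex_on_nonneg[OF g(2)] lim]) simp
    qed
    then show ?case by (simp add: R_def)
  qed
qed

text \<open>The finite maxima have no lower bound valid for all \<open>\<omega>\<close>. Subtracting
  \<open>X x0\<close>, which is almost surely 0, makes them nonnegative everywhere without changing
  the limit or the expectations.\<close>

lemma supremum_limit:
  fixes X :: "real \<Rightarrow> 'a \<Rightarrow> real"
  assumes X: "centered_gaussian_process M S C X" "continuous_paths M S X" and S: "compact S"
    and x0: "x0 \<in> S" "C x0 x0 = 0"
    and J: "\<And>n. finite (J n)" "\<And>n. x0 \<in> J n" "\<And>n. J n \<subseteq> S" "incseq J" "S \<subseteq> closure (\<Union>n. J n)"
  shows "extended_expectation M (\<lambda>\<omega>. SUP t\<in>S. X t \<omega>) =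
    enn2ereal (SUP n. ennreal ((\<integral>\<omega>. max_range (J n) (\<lambda>t. X t \<omega>) \<partial>M) / 2))"
proof -
  note mX = centered_gaussian_process_moments[OF X(1)]
  have ne: "J n \<noteq> {}" for n using J(2) by auto
  note Max = Max_integral_eq_half_range[OF centered_gaussian_process_subset[OF X(1) J(3)] J(1) ne]
  have "integrable M (\<lambda>\<omega>. (X x0 \<omega>)\<^sup>2)" "(\<integral>\<omega>. (X x0 \<omega>)\<^sup>2 \<partial>M) = 0"
    using mX(6)[OF x0(1) x0(1)] mX(7)[OF x0(1) x0(1)] x0(2) by (simp_all add: power2_eq_square)
  then have "AE \<omega> in M. (X x0 \<omega>)\<^sup>2 = 0"
    by (subst (asm) integral_nonneg_eq_0_iff_AE) auto
  then have X0: "AE \<omega> in M. X x0 \<omega> = 0" by simp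
  define F where "F n \<omega> = Max ((\<lambda>t. X t \<omega>) ` J n) - X x0 \<omega>" for n \<omega>
  have F0: "0 \<le> F n \<omega>" for n \<omega>
    unfolding F_def using J(1,2) by (simp add: Max_ge)
  have intF: "integrable M (F n)" "(\<integral>\<omega>. F n \<omega> \<partial>M) = (\<integral>\<omega>. max_range (J n) (\<lambda>t. X t \<omega>) \<partial>M) / 2" for n
    unfolding F_def using Max[of n] mX(4,5)[OF x0(1)] by auto
  have "extended_expectation M (\<lambda>\<omega>. SUP t\<in>S. X t \<omega>) =
      ereal 0 + enn2ereal (SUP n. \<integral>\<^sup>+\<omega>. ennreal (F n \<omega> - 0) \<partial>M)"
  proof (rule extended_expectation_limit)
    show "prob_space M" by (rule mX)
    show "F n \<in> borel_measurable M" for n using intF(1) by auto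
    show "incseq (\<lambda>n. F n \<omega>)" for \<omega>
      unfolding F_def incseq_def
      by (intro allI impI diff_right_mono Max_mono image_mono incseqD[OF J(4)]) (use J(1) ne in auto)
    have "AE \<omega> in M. continuous_on S (\<lambda>t. X t \<omega>)" using X(2) by (simp add: continuous_paths_def)
    then show "AE \<omega> in M. (\<lambda>n. F n \<omega>) \<longlonglongrightarrow> (SUP t\<in>S. X t \<omega>)"
      using X0
    proof eventually_elim
      case (elim \<omega>)
      then show ?case
        using Max_tendsto_SUP[OF elim(1) S _ J(1) ne J(3-5)] x0 by (auto simp: F_def)
    qed
  qed (rule F0)
  moreover have "(\<integral>\<^sup>+\<omega>. ennreal (F n \<omega> - 0) \<partial>M) = ennreal ((\<integral>\<omega>. max_range (J n) (\<lambda>t. X t \<omega>) \<partial>M) / 2)" for n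
    using nn_integral_eq_integral[OF intF(1), of n] F0 intF(2)[of n] by simp
  ultimately show ?thesis by simp
qed

theorem theorem2p5:
  fixes H K T :: real
    and M :: "'a measure" and N :: "'b measure"
    and W :: "real \<Rightarrow> 'a \<Rightarrow> real"
    and B Y :: "real \<Rightarrow> 'b \<Rightarrow> real"
  assumes "0 < H" "H < 1" "0 < K" "K \<le> 1" "0 < T"
    and "bifractional_brownian_motion M {0..T} H K W"
    and "continuous_paths M {0..T} W"
    and "fractional_brownian_motion N {0..T} (H * K) B"
    and "continuous_paths N {0..T} B"
    and "\<And>t \<omega>. t \<in> {0..T} \<Longrightarrow> Y t \<omega> = 2 powr ((1 - K) / 2) * B t \<omega>"
  shows "(\<forall>g :: real \<Rightarrow> real. mono_on {0..} g \<and> convex_on {0..} g \<longrightarrow>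
            extended_expectation M (\<lambda>\<omega>. g (SUP (t, s) \<in> {0..T} \<times> {0..T}. W t \<omega> - W s \<omega>))
          \<le> extended_expectation N (\<lambda>\<omega>. g (SUP (t, s) \<in> {0..T} \<times> {0..T}. Y t \<omega> - Y s \<omega>)))
       \<and> extended_expectation M (\<lambda>\<omega>. SUP t \<in> {0..T}. W t \<omega>)
          \<le> extended_expectation N (\<lambda>\<omega>. SUP t \<in> {0..T}. Y t \<omega>)"
proof -
  let ?I = "{0..T}"
  \<comment> \<open>The hypothesis on \<open>Y\<close> speaks only of times in the interval;
    \<open>Z\<close> satisfies the equation at all times and has the same suprema.\<close>
  define Z where "Z t \<omega> = 2 powr ((1 - K) / 2) * B t \<omega>" for t \<omega>
  define D where "D s t = 2 powr (1 - K) * fractional_cov (H * K) s t" for s t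
  have YZ: "(SUP t\<in>?I. Y t \<omega>) = (SUP t\<in>?I. Z t \<omega>)"
    "(SUP (t, s)\<in>?I \<times> ?I. Y t \<omega> - Y s \<omega>) = (SUP (t, s)\<in>?I \<times> ?I. Z t \<omega> - Z s \<omega>)" for \<omega>
    using assms(10) by (auto simp: Z_def intro!: arg_cong[where f=Sup] image_cong)
  have W: "centered_gaussian_process M ?I (bifractional_cov H K) W"
    using assms(6) by (simp add: bifractional_brownian_motion_def)
  have "centered_gaussian_process N ?I (fractional_cov (H * K)) B"
    using assms(8) by (simp add: fractional_brownian_motion_def)
  from centered_gaussian_process_scale[OF this, of "2 powr ((1 - K) / 2)"]
  have Z: "centered_gaussian_process N ?I D Z"
    by (simp add: D_def[abs_def] Z_def[abs_def] power2_eq_square powr_add[symmetric])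
  have Zc: "continuous_paths N ?I Z"
    using assms(9) unfolding continuous_paths_def Z_def
    by (auto elim!: eventually_mono intro!: continuous_on_mult_left)
  note mW = centered_gaussian_process_moments[OF W] and mZ = centered_gaussian_process_moments[OF Z]
  have 0: "0 \<in> ?I" "bifractional_cov H K 0 0 = 0" "D 0 0 = 0"
    using assms(1,3,5) by (auto simp: bifractional_cov_def D_def fractional_cov_def)
  obtain J where J: "\<And>n. finite (J n)" "\<And>n. 0 \<in> J n" "\<And>n. J n \<subseteq> ?I" "incseq J" "?I \<subseteq> closure (\<Union>n. J n)"
    using finite_exhaustion_dense[OF 0(1)] by metis
  have ne: "J n \<noteq> {}" for n using J(2) by auto
  have comp: "(\<integral>\<omega>. max (max_range (J n) (\<lambda>t. W t \<omega>)) a \<partial>M) \<le> (\<integral>\<omega>. max (max_range (J n) (\<lambda>t. Z t \<omega>)) a \<partial>N)" for n a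
    by (rule max_range_comparison[OF centered_gaussian_process_subset[OF W J(3)]
          centered_gaussian_process_subset[OF Z[unfolded D_def[abs_def]] J(3)] J(1) ne])
       (rule bifractional_increment_le[OF assms(3,4)])
  have int: "integrable M (\<lambda>\<omega>. max_range (J n) (\<lambda>t. W t \<omega>))" "integrable N (\<lambda>\<omega>. max_range (J n) (\<lambda>t. Z t \<omega>))" for n
    by (rule max_range_integrable[OF mW(1) J(1) ne mW(4)] max_range_integrable[OF mZ(1) J(1) ne mZ(4)],
        use J(3) in blast)+
  have nonneg: "0 \<le> max_range (J n) x" for n x by (rule max_range_nonneg[OF J(1) ne])
  have range: "extended_expectation M (\<lambda>\<omega>. g (SUP (t, s)\<in>?I \<times> ?I. W t \<omega> - W s \<omega>))
      \<le> extended_expectation N (\<lambda>\<omega>. g (SUP (t, s)\<in>?I \<times> ?I. Z t \<omega> - Z s \<omega>))"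
    if g: "mono_on {0..} g" "convex_on {0..} g" for g
  proof -
    have S: "compact ?I" "?I \<noteq> {}" using 0 by auto
    have "(SUP n. \<integral>\<^sup>+\<omega>. ennreal (g (max_range (J n) (\<lambda>t. W t \<omega>)) - g 0) \<partial>M)
        \<le> (SUP n. \<integral>\<^sup>+\<omega>. ennreal (g (max_range (J n) (\<lambda>t. Z t \<omega>)) - g 0) \<partial>N)"
      by (intro SUP_mono' increasing_convex_order[OF mW(1) int(1) nonneg mZ(1) int(2) nonneg comp g])
    then show ?thesis
      unfolding range_functional_limit[OF W assms(7) S J(1) ne J(3-5) g] range_functional_limit[OF Z Zc S J(1) ne J(3-5) g]
      by (intro add_left_mono) (simp add: less_eq_ennreal.rep_eq)
  qed
  have sup: "extended_expectation M (\<lambda>\<omega>. SUP t\<in>?I. W t \<omega>) \<le> extended_expectation N (\<lambda>\<omega>. SUP t\<in>?I. Z t \<omega>)"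
  proof -
    have "(\<integral>\<omega>. max_range (J n) (\<lambda>t. W t \<omega>) \<partial>M) \<le> (\<integral>\<omega>. max_range (J n) (\<lambda>t. Z t \<omega>) \<partial>N)" for n
      \<comment> \<open>Ranges are nonnegative, so the threshold 0 leaves them unchanged and the
        comparison concerns the expected ranges themselves.\<close>
      using comp[of n 0] nonneg by (simp add: max_absorb1)
    then have "(SUP n. ennreal ((\<integral>\<omega>. max_range (J n) (\<lambda>t. W t \<omega>) \<partial>M) / 2))
        \<le> (SUP n. ennreal ((\<integral>\<omega>. max_range (J n) (\<lambda>t. Z t \<omega>) \<partial>N) / 2))"
      by (intro SUP_mono' ennreal_leI divide_right_mono) auto
    then show ?thesis
      unfolding supremum_limit[OF W assms(7) compact_Icc 0(1,2) J] supremum_limit[OF Z Zc compact_Icc 0(1,3) J]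
      by (simp add: less_eq_ennreal.rep_eq)
  qed
  show ?thesis unfolding YZ using range sup by blast
qed

end
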